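(* For any integer $k\ge2$, every directed graph whose underlying undirected graph is $\lceil\tfrac{6k}{k-1}\rceil$-edge-connected has a $\mathbb{Z}_{2k+1}$-antisymmetric flow.
   Context: Graphs are finite and may have multiple edges but no loops. For an abelian group $B$ and a directed graph $\vec G=(V,\vec E)$, a $B$-flow is a map $f:\vec E\to B$ such that for every vertex $v$, the sum of $f$ over arcs leaving $v$ minus the sum of $f$ over arcs entering $v$ equals $0$ in $B$. A $B$-flow $f$ is antisymmetric if no two arcs (not necessarily distinct) receive mutually inverse elements, i.e. there are no arcs $\vec e,\vec e'$ with $f(\vec e)=-f(\vec e')$; in particular $0\notin f(\vec E)$. *)

theory Defs
  imports Complex_Main "HOL-Number_Theory.Cong"
begin

definition digraph :: "'v set \<Rightarrow> 'e set \<Rightarrow> ('e \<Rightarrow> 'v) \<Rightarrow> ('e \<Rightarrow> 'v) \<Rightarrow> bool" where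
  "digraph V E tail head \<longleftrightarrow> finite V \<and> finite E \<and>
     (\<forall>e\<in>E. tail e \<in> V \<and> head e \<in> V \<and> tail e \<noteq> head e)"

definition cut_edges :: "'e set \<Rightarrow> ('e \<Rightarrow> 'v) \<Rightarrow> ('e \<Rightarrow> 'v) \<Rightarrow> 'v set \<Rightarrow> 'e set" where
  "cut_edges E tail head X = {e\<in>E. (tail e \<in> X) \<noteq> (head e \<in> X)}"

definition edge_connected :: "nat \<Rightarrow> 'v set \<Rightarrow> 'e set \<Rightarrow> ('e \<Rightarrow> 'v) \<Rightarrow> ('e \<Rightarrow> 'v) \<Rightarrow> bool" where
  "edge_connected l V E tail head \<longleftrightarrow>
     (\<forall>X. X \<subseteq> V \<and> X \<noteq> {} \<and> X \<noteq> V \<longrightarrow> l \<le> card (cut_edges E tail head X))"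

definition is_Zmod_flow :: "int \<Rightarrow> 'v set \<Rightarrow> 'e set \<Rightarrow> ('e \<Rightarrow> 'v) \<Rightarrow> ('e \<Rightarrow> 'v) \<Rightarrow> ('e \<Rightarrow> int) \<Rightarrow> bool" where
  "is_Zmod_flow m V E tail head f \<longleftrightarrow>
     (\<forall>v\<in>V. [(\<Sum>e\<in>{e\<in>E. tail e = v}. f e) - (\<Sum>e\<in>{e\<in>E. head e = v}. f e) = 0] (mod m))"

definition is_antisymmetric_Zmod_flow :: "int \<Rightarrow> 'v set \<Rightarrow> 'e set \<Rightarrow> ('e \<Rightarrow> 'v) \<Rightarrow> ('e \<Rightarrow> 'v) \<Rightarrow> ('e \<Rightarrow> int) \<Rightarrow> bool" where
  "is_antisymmetric_Zmod_flow m V E tail head f \<longleftrightarrow>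
     is_Zmod_flow m V E tail head f \<and> (\<forall>e\<in>E. \<forall>e'\<in>E. \<not> [f e = - f e'] (mod m))"

end

theory Submission
  imports Defs
begin

text \<open>
  Put \<open>m = 2 k + 1\<close> and replace every arc by \<open>k - 1\<close> parallel copies; the resulting graph is
  \<open>3 (m - 1)\<close>-edge-connected, so by a theorem of Lovasz, Thomassen, Wu and Zhang it has
  orientations with all out-degrees prescribed modulo \<open>m\<close>. If \<open>j\<close> copies of an arc keep their
  direction, the arc gets the value \<open>2 j + 2\<close>, one of \<open>2, 4, \<dots>, 2 k\<close>, and no two of these are
  opposite modulo \<open>m\<close>; the prescribed out-degrees make this a flow.

  The orientation theorem is proved by induction for graphs attached to an external root, whose
  arcs are already directed and enter only through their numbers \<open>a v\<close> (from the root to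
  \<open>v\<close>) and \<open>b v\<close> (from \<open>v\<close> to the root). If a set \<open>A\<close> with at least two vertices
  satisfies its cut condition without slack, one orients the contraction of \<open>A\<close> and then \<open>A\<close>
  itself, with everything outside \<open>A\<close> as the new root. Otherwise all these cut conditions survive
  a small change: vertices that need equally many arcs in both directions are split off, and
  other edges can be oriented and deleted, if necessary after adding \<open>m - 1\<close> arcs
  at the root.
\<close>

section \<open>Cut counts and prescribed out-degrees\<close>

definition inner :: "'e set \<Rightarrow> ('e \<Rightarrow> 'v) \<Rightarrow> ('e \<Rightarrow> 'v) \<Rightarrow> 'v set \<Rightarrow> int" where
  "inner E t h A = (\<Sum>e\<in>E. of_bool (t e \<in> A \<and> h e \<in> A))"

definition touching :: "'e set \<Rightarrow> ('e \<Rightarrow> 'v) \<Rightarrow> ('e \<Rightarrow> 'v) \<Rightarrow> 'v set \<Rightarrow> int" where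
  "touching E t h A = (\<Sum>e\<in>E. of_bool (t e \<in> A \<or> h e \<in> A))"

text \<open>
  In an orientation with out-degrees \<open>p\<close>, exactly \<open>leaving A\<close> arcs leave \<open>A\<close> and
  \<open>entering A\<close> arcs enter it, arcs at the root included. If only the residues modulo \<open>m\<close> of
  \<open>p\<close> are prescribed, the pair is determined up to shifts by \<open>(m k, - m k)\<close>.
\<close>

definition leaving :: "'e set \<Rightarrow> ('e \<Rightarrow> 'v) \<Rightarrow> ('e \<Rightarrow> 'v) \<Rightarrow> ('v \<Rightarrow> int) \<Rightarrow> ('v \<Rightarrow> int) \<Rightarrow> 'v set \<Rightarrow> int" where
  "leaving E t h p b A = sum p A + sum b A - inner E t h A"

definition entering :: "'e set \<Rightarrow> ('e \<Rightarrow> 'v) \<Rightarrow> ('e \<Rightarrow> 'v) \<Rightarrow> ('v \<Rightarrow> int) \<Rightarrow> ('v \<Rightarrow> int) \<Rightarrow> 'v set \<Rightarrow> int" where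
  "entering E t h p a A = sum a A - sum p A + touching E t h A"

text \<open>With \<open>x\<close> and \<open>y\<close> the numbers of arcs leaving and entering a
  set, some pair with the prescribed residues has at least \<open>c\<close> arcs each way. The cut
  condition is the case \<open>c = m - 1\<close>; its form with slack one is
  \<open>c = m\<close>.\<close>

definition feasible :: "int \<Rightarrow> int \<Rightarrow> int \<Rightarrow> int \<Rightarrow> bool" where
  "feasible m c x y \<longleftrightarrow> (\<exists>k. c \<le> x + m * k \<and> c \<le> y - m * k)"

definition balanced :: "int \<Rightarrow> int \<Rightarrow> int \<Rightarrow> bool" where
  "balanced m x y \<longleftrightarrow> (\<exists>k. x + m * k = y - m * k)"

text \<open>Here \<open>t\<close> and \<open>h\<close> only name the two ends of an undirected edge;
  \<open>s e\<close> tells whether \<open>e\<close> runs from \<open>t e\<close> to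
  \<open>h e\<close> or back.\<close>

definition src :: "('e \<Rightarrow> bool) \<Rightarrow> ('e \<Rightarrow> 'v) \<Rightarrow> ('e \<Rightarrow> 'v) \<Rightarrow> 'e \<Rightarrow> 'v" where
  "src s t h e = (if s e then t e else h e)"

definition outdeg :: "('e \<Rightarrow> bool) \<Rightarrow> 'e set \<Rightarrow> ('e \<Rightarrow> 'v) \<Rightarrow> ('e \<Rightarrow> 'v) \<Rightarrow> 'v \<Rightarrow> int" where
  "outdeg s E t h v = (\<Sum>e\<in>E. of_bool (src s t h e = v))"

text \<open>Root arcs are already directed, so \<open>p\<close> counts only the edges of
  \<open>E\<close>.\<close>

definition orientable :: "int \<Rightarrow> 'v set \<Rightarrow> 'e set \<Rightarrow> ('e \<Rightarrow> 'v) \<Rightarrow> ('e \<Rightarrow> 'v) \<Rightarrow> ('v \<Rightarrow> int) \<Rightarrow> bool" where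
  "orientable m V E t h p \<longleftrightarrow> (\<exists>s. \<forall>v\<in>V. [outdeg s E t h v = p v] (mod m))"

text \<open>
  The condition on \<open>V\<close> bounds the root: of the numbers of arcs into and out of it, one
  is at most \<open>m - 1\<close> and the other at most \<open>2 m - 1\<close>. One vertex \<open>u\<close> may violate its cut
  condition, provided it needs as many arcs in as out; this keeps the condition stable
  while edges at \<open>u\<close> are split off.
\<close>

definition admissible :: "int \<Rightarrow> 'v set \<Rightarrow> 'e set \<Rightarrow> ('e \<Rightarrow> 'v) \<Rightarrow> ('e \<Rightarrow> 'v) \<Rightarrow>
    ('v \<Rightarrow> int) \<Rightarrow> ('v \<Rightarrow> int) \<Rightarrow> ('v \<Rightarrow> int) \<Rightarrow> 'v \<Rightarrow> bool" where
  "admissible m V E t h p a b u \<longleftrightarrow>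
     finite V \<and> V \<noteq> {} \<and> finite E \<and> (\<forall>e\<in>E. t e \<in> V \<and> h e \<in> V \<and> t e \<noteq> h e) \<and>
     (\<forall>v\<in>V. 0 \<le> a v \<and> 0 \<le> b v) \<and> [sum p V = int (card E)] (mod m) \<and>
     \<not> feasible m m (leaving E t h p b V) (entering E t h p a V) \<and>
     (\<forall>A. A \<subseteq> V \<and> A \<noteq> {} \<and> A \<noteq> V \<longrightarrow>
        feasible m (m - 1) (leaving E t h p b A) (entering E t h p a A) \<or>
        A = {u} \<and> balanced m (leaving E t h p b A) (entering E t h p a A))"

definition joins :: "('e \<Rightarrow> 'v) \<Rightarrow> ('e \<Rightarrow> 'v) \<Rightarrow> 'e \<Rightarrow> 'v \<Rightarrow> 'v \<Rightarrow> bool" where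
  "joins t h e x y \<longleftrightarrow> t e = x \<and> h e = y \<or> t e = y \<and> h e = x"

lemma admissibleD:
  assumes "admissible m V E t h p a b u"
  shows "finite V" "V \<noteq> {}" "finite E" "\<And>e. e \<in> E \<Longrightarrow> t e \<in> V \<and> h e \<in> V \<and> t e \<noteq> h e"
    "\<And>v. v \<in> V \<Longrightarrow> 0 \<le> a v" "\<And>v. v \<in> V \<Longrightarrow> 0 \<le> b v" "[sum p V = int (card E)] (mod m)"
    "\<not> feasible m m (leaving E t h p b V) (entering E t h p a V)"
    "\<And>A. \<lbrakk>A \<subseteq> V; A \<noteq> {}; A \<noteq> V\<rbrakk> \<Longrightarrow> feasible m (m - 1) (leaving E t h p b A) (entering E t h p a A) \<or>
        A = {u} \<and> balanced m (leaving E t h p b A) (entering E t h p a A)"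
  using assms unfolding admissible_def by blast+

section \<open>Shifts of count pairs and bookkeeping for edges\<close>

text \<open>The same shift \<open>k\<close> works. With \<open>c = m\<close> and
  \<open>d = m - 1\<close> this absorbs the loss of one arc in each direction.\<close>

lemma feasible_mono: "\<lbrakk>feasible m c x y; x + d \<le> x' + c; y + d \<le> y' + c\<rbrakk> \<Longrightarrow> feasible m d x' y'"
  unfolding feasible_def by (elim ex_forward) linarith

lemma feasible_shift: "feasible m c (x + m * j) (y - m * j) \<longleftrightarrow> feasible m c x y"
  unfolding feasible_def
proof (intro iffI; elim exE)
  fix k
  show "\<exists>k. c \<le> x + m * k \<and> c \<le> y - m * k"
    if "c \<le> x + m * j + m * k \<and> c \<le> y - m * j - m * k"
    using that by (intro exI[of _ "j + k"]) (simp add: algebra_simps)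
  show "\<exists>k. c \<le> x + m * j + m * k \<and> c \<le> y - m * j - m * k"
    if "c \<le> x + m * k \<and> c \<le> y - m * k"
    using that by (intro exI[of _ "k - j"]) (simp add: algebra_simps)
qed

lemma balanced_diff: "balanced m x y \<Longrightarrow> balanced m (x - d) (y - d)"
  unfolding balanced_def by (elim ex_forward) linarith

lemma sum_fun_upd_add:
  fixes f :: "'v \<Rightarrow> int"
  assumes "finite A"
  shows "sum (f(y := f y + c)) A = sum f A + c * of_bool (y \<in> A)"
proof -
  have "sum (f(y := f y + c)) A = (\<Sum>v\<in>A. f v + (if y = v then c else 0))"
    by (rule sum.cong) auto
  then show ?thesis
    using assms by (simp add: sum.distrib sum.delta')
qed

lemma sum_fun_upd_diff:
  fixes f :: "'v \<Rightarrow> int"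
  assumes "finite A"
  shows "sum (f(y := f y - c)) A = sum f A - c * of_bool (y \<in> A)"
  using sum_fun_upd_add[OF assms, of f y "- c"] by simp

lemma joins_src: "joins t h e x y \<Longrightarrow> src (s(e := (t e = x))) t h e = x"
  by (auto simp: joins_def src_def)

lemma inner_remove:
  assumes "finite E" "e \<in> E" "joins t h e x y"
  shows "inner (E - {e}) t h A = inner E t h A - of_bool (x \<in> A \<and> y \<in> A)"
  using assms unfolding inner_def joins_def
  by (subst sum.remove[OF assms(1,2)]) auto

lemma touching_remove:
  assumes "finite E" "e \<in> E" "joins t h e x y"
  shows "touching (E - {e}) t h A = touching E t h A - of_bool (x \<in> A \<or> y \<in> A)"
  using assms unfolding touching_def joins_def
  by (subst sum.remove[OF assms(1,2)]) auto

lemma outdeg_remove: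
  assumes "finite E" "e \<in> E"
  shows "outdeg s E t h v = outdeg s (E - {e}) t h v + of_bool (src s t h e = v)"
  unfolding outdeg_def by (subst sum.remove[OF assms]) auto

lemma outdeg_cong:
  assumes "\<And>e. e \<in> E \<Longrightarrow> src s t h e = src s' t' h' e"
  shows "outdeg s E t h v = outdeg s' E t' h' v"
  unfolding outdeg_def by (rule sum.cong) (use assms in auto)

section \<open>Small changes: deleting and splitting off edges\<close>

text \<open>Sets with at least two vertices have slack one, so a change that lowers each of their
  counts by at most one preserves their condition. Only the root bound and the single vertices
  remain to be checked.\<close>

lemma admissible_edit:
  assumes I: "admissible m V E t h p a b u"
    and strict: "\<And>A. \<lbrakk>A \<subseteq> V; 2 \<le> card A; A \<noteq> V\<rbrakk> \<Longrightarrow> feasible m m (leaving E t h p b A) (entering E t h p a A)"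
    and edges: "finite E'" "\<And>e. e \<in> E' \<Longrightarrow> t' e \<in> V \<and> h' e \<in> V \<and> t' e \<noteq> h' e"
    and nonneg: "\<And>v. v \<in> V \<Longrightarrow> 0 \<le> a' v" "\<And>v. v \<in> V \<Longrightarrow> 0 \<le> b' v"
    and total: "sum p' V - int (card E') = sum p V - int (card E)"
    and top: "\<not> feasible m m (leaving E' t' h' p' b' V) (entering E' t' h' p' a' V)"
    and large: "\<And>A. A \<subseteq> V \<Longrightarrow> leaving E t h p b A - 1 \<le> leaving E' t' h' p' b' A"
      "\<And>A. A \<subseteq> V \<Longrightarrow> entering E t h p a A - 1 \<le> entering E' t' h' p' a' A"
    and single: "\<And>v. \<lbrakk>v \<in> V; V \<noteq> {v}\<rbrakk> \<Longrightarrow> feasible m (m - 1) (leaving E' t' h' p' b' {v}) (entering E' t' h' p' a' {v}) \<or>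
        v = u' \<and> balanced m (leaving E' t' h' p' b' {v}) (entering E' t' h' p' a' {v})"
  shows "admissible m V E' t' h' p' a' b' u'"
proof -
  have "[sum p' V = int (card E')] (mod m)"
    using admissibleD(7)[OF I] total by (simp add: cong_iff_dvd_diff)
  moreover have "feasible m (m - 1) (leaving E' t' h' p' b' A) (entering E' t' h' p' a' A) \<or>
        A = {u'} \<and> balanced m (leaving E' t' h' p' b' A) (entering E' t' h' p' a' A)"
    if A: "A \<subseteq> V" "A \<noteq> {}" "A \<noteq> V" for A
  proof (cases "2 \<le> card A")
    case True
    have "feasible m (m - 1) (leaving E' t' h' p' b' A) (entering E' t' h' p' a' A)"
      using feasible_mono[OF strict[OF A(1) True A(3)]] large[OF A(1)] by simp
    then show ?thesis by simp
  next
    case False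
    have "finite A" using A(1) admissibleD(1)[OF I] finite_subset by blast
    then have "card A = 1" using False A(2) by (simp add: card_eq_0_iff le_less_Suc_eq not_le numeral_2_eq_2 less_Suc_eq)
    then obtain v where "A = {v}" by (auto simp: card_1_singleton_iff)
    then show ?thesis using single[of v] A by auto
  qed
  ultimately show ?thesis
    unfolding admissible_def using admissibleD(1,2)[OF I] edges nonneg top by simp
qed

text \<open>Directing \<open>e\<close> from \<open>x\<close> to \<open>y\<close> uses up one unit of
  \<open>p x\<close>.\<close>

lemma orientable_delete:
  assumes "finite E" "e \<in> E" "joins t h e x y"
    and "orientable m V (E - {e}) t h (p(x := p x - 1))"
  shows "orientable m V E t h p"
proof -
  obtain s where s: "\<And>v. v \<in> V \<Longrightarrow> [outdeg s (E - {e}) t h v = (p(x := p x - 1)) v] (mod m)"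
    using assms(4) unfolding orientable_def by blast
  define s' where "s' = s(e := (t e = x))"
  have "outdeg s' E t h v = outdeg s (E - {e}) t h v + of_bool (x = v)" for v
  proof -
    have "outdeg s' (E - {e}) t h v = outdeg s (E - {e}) t h v"
      by (rule outdeg_cong) (auto simp: s'_def src_def)
    then show ?thesis
      using outdeg_remove[OF assms(1,2), of s' t h v] joins_src[OF assms(3), of s] by (simp add: s'_def)
  qed
  then have "[outdeg s' E t h v = p v] (mod m)" if "v \<in> V" for v
    using s[OF that] by (cases "v = x") (auto simp: cong_iff_dvd_diff algebra_simps)
  then show ?thesis unfolding orientable_def by blast
qed

text \<open>Splitting off at \<open>u\<close>: the edges from \<open>u\<close> to \<open>y\<close>
  and to \<open>w\<close> are replaced by one edge between \<open>y\<close> and \<open>w\<close>,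
  which reuses the name \<open>e\<close>. Either direction of that edge pulls back to a directed
  path through \<open>u\<close>, which gives \<open>u\<close> exactly one outgoing arc.\<close>

lemma orientable_lift:
  assumes E: "finite E" "e \<in> E" "e' \<in> E" "e \<noteq> e'"
    and J: "joins t h e u y" "joins t h e' u w" and ne: "y \<noteq> w" "u \<noteq> y" "u \<noteq> w"
    and o: "orientable m V (E - {e'}) (t(e := y)) (h(e := w)) (p(u := p u - 1))"
  shows "orientable m V E t h p"
proof -
  obtain s where s: "\<And>v. v \<in> V \<Longrightarrow>
      [outdeg s (E - {e'}) (t(e := y)) (h(e := w)) v = (p(u := p u - 1)) v] (mod m)"
    using o unfolding orientable_def by blast
  define x where "x = src s (t(e := y)) (h(e := w)) e"
  \<comment> \<open>If \<open>s e\<close> holds, the new edge runs from \<open>y\<close> to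
    \<open>w\<close>, so \<open>e\<close> gets tail \<open>y\<close> and \<open>e'\<close> gets tail
    \<open>u\<close>; otherwise the path runs from \<open>w\<close> over \<open>u\<close> to
    \<open>y\<close>.\<close>
  define s' where "s' = s(e := (if s e then t e = y else t e = u), e' := (if s e then t e' = u else t e' = w))"
  have 1: "e \<in> E - {e'}" using E by auto
  have "outdeg s' E t h v = outdeg s (E - {e'}) (t(e := y)) (h(e := w)) v + of_bool (u = v)" for v
  proof -
    have "outdeg s' (E - {e'} - {e}) t h v = outdeg s (E - {e'} - {e}) (t(e := y)) (h(e := w)) v"
      by (rule outdeg_cong) (auto simp: s'_def src_def)
    moreover have "of_bool (src s' t h e = v) + of_bool (src s' t h e' = v)
        = of_bool (x = v) + (of_bool (u = v) :: int)"
      using J ne E(4) unfolding x_def s'_def src_def joins_def by (cases "s e") auto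
    ultimately show ?thesis
      using outdeg_remove[OF E(1,3), of s' t h v] outdeg_remove[of "E - {e'}" e s' t h v]
        outdeg_remove[of "E - {e'}" e s "t(e := y)" "h(e := w)" v] 1 E(1)
      by (simp add: x_def)
  qed
  then have "[outdeg s' E t h v = p v] (mod m)" if "v \<in> V" for v
    using s[OF that] by (cases "v = u") (auto simp: cong_iff_dvd_diff algebra_simps)
  then show ?thesis unfolding orientable_def by blast
qed

lemma leaving_upd: "finite A \<Longrightarrow> leaving E t h p (b(v := b v + c)) A = leaving E t h p b A + c * of_bool (v \<in> A)"
  unfolding leaving_def by (simp only: sum_fun_upd_add)

lemma entering_upd: "finite A \<Longrightarrow> entering E t h p (a(v := a v + c)) A = entering E t h p a A + c * of_bool (v \<in> A)"
  unfolding entering_def by (simp only: sum_fun_upd_add)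

lemma leaving_delete:
  assumes "finite E" "e \<in> E" "joins t h e x y" "finite A"
  shows "leaving (E - {e}) t h (p(x := p x - 1)) b A = leaving E t h p b A - of_bool (x \<in> A \<and> y \<notin> A)"
  unfolding leaving_def inner_remove[OF assms(1-3)] sum_fun_upd_diff[OF assms(4)] by auto

lemma entering_delete:
  assumes "finite E" "e \<in> E" "joins t h e x y" "finite A"
  shows "entering (E - {e}) t h (p(x := p x - 1)) a A = entering E t h p a A - of_bool (x \<notin> A \<and> y \<in> A)"
  unfolding entering_def touching_remove[OF assms(1-3)] sum_fun_upd_diff[OF assms(4)] by auto

lemma inner_lift:
  assumes "finite E" "e \<in> E" "e' \<in> E" "e \<noteq> e'" "joins t h e u y" "joins t h e' u w"
  shows "inner (E - {e'}) (t(e := y)) (h(e := w)) A = inner E t h A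
     - of_bool (u \<in> A \<and> y \<in> A) - of_bool (u \<in> A \<and> w \<in> A) + of_bool (y \<in> A \<and> w \<in> A)"
proof -
  have 1: "finite (E - {e'})" "e \<in> E - {e'}" using assms by auto
  have "inner (E - {e'} - {e}) (t(e := y)) (h(e := w)) A = inner (E - {e'} - {e}) t h A"
    unfolding inner_def by (rule sum.cong) auto
  moreover have "joins (t(e := y)) (h(e := w)) e y w" by (simp add: joins_def)
  ultimately show ?thesis
    using inner_remove[OF 1 assms(5), of A] inner_remove[OF assms(1,3,6), of A]
      inner_remove[OF 1, of "t(e := y)" "h(e := w)" y w A] by simp
qed

lemma touching_lift:
  assumes "finite E" "e \<in> E" "e' \<in> E" "e \<noteq> e'" "joins t h e u y" "joins t h e' u w"
  shows "touching (E - {e'}) (t(e := y)) (h(e := w)) A = touching E t h A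
     - of_bool (u \<in> A \<or> y \<in> A) - of_bool (u \<in> A \<or> w \<in> A) + of_bool (y \<in> A \<or> w \<in> A)"
proof -
  have 1: "finite (E - {e'})" "e \<in> E - {e'}" using assms by auto
  have "touching (E - {e'} - {e}) (t(e := y)) (h(e := w)) A = touching (E - {e'} - {e}) t h A"
    unfolding touching_def by (rule sum.cong) auto
  moreover have "joins (t(e := y)) (h(e := w)) e y w" by (simp add: joins_def)
  ultimately show ?thesis
    using touching_remove[OF 1 assms(5), of A] touching_remove[OF assms(1,3,6), of A]
      touching_remove[OF 1, of "t(e := y)" "h(e := w)" y w A] by simp
qed

text \<open>Only when the cut separates \<open>u\<close> from both \<open>y\<close> and
  \<open>w\<close> does the path through \<open>u\<close> cross it twice, once each way, while the
  new edge does not cross it. In all other cases path and new edge cross equally.\<close>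

lemma leaving_lift:
  assumes "finite E" "e \<in> E" "e' \<in> E" "e \<noteq> e'" "joins t h e u y" "joins t h e' u w" "finite A"
  shows "leaving (E - {e'}) (t(e := y)) (h(e := w)) (p(u := p u - 1)) b A
     = leaving E t h p b A - of_bool ((u \<in> A) \<noteq> (y \<in> A) \<and> (y \<in> A) = (w \<in> A))"
  unfolding leaving_def inner_lift[OF assms(1-6)] sum_fun_upd_diff[OF assms(7)] by auto

lemma entering_lift:
  assumes "finite E" "e \<in> E" "e' \<in> E" "e \<noteq> e'" "joins t h e u y" "joins t h e' u w" "finite A"
  shows "entering (E - {e'}) (t(e := y)) (h(e := w)) (p(u := p u - 1)) a A
     = entering E t h p a A - of_bool ((u \<in> A) \<noteq> (y \<in> A) \<and> (y \<in> A) = (w \<in> A))"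
  unfolding entering_def touching_lift[OF assms(1-6)] sum_fun_upd_diff[OF assms(7)] by auto

lemma joins_neq: "admissible m V E t h p a b u \<Longrightarrow> e \<in> E \<Longrightarrow> joins t h e x y \<Longrightarrow> x \<in> V \<and> y \<in> V \<and> x \<noteq> y"
  using admissibleD(4) unfolding joins_def by metis

lemma joins_sym: "joins t h e x y \<Longrightarrow> joins t h e y x"
  by (auto simp: joins_def)

lemma total_delete:
  assumes "finite V" "finite E" "e \<in> E" "x \<in> V"
  shows "sum (p(x := p x - 1)) V - int (card (E - {e})) = sum p V - int (card E)"
proof -
  have "int (card E) = int (card (E - {e})) + 1"
    unfolding card.remove[OF assms(2,3)] by simp
  then show ?thesis
    unfolding sum_fun_upd_diff[OF assms(1)] using assms(4) by simp
qed

text \<open>At \<open>u\<close> both counts drop by one, which preserves balance even where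
  feasibility is lost. Every other single vertex keeps its counts because \<open>y\<close> and
  \<open>w\<close> differ.\<close>

lemma admissible_lift:
  assumes I: "admissible m V E t h p a b u"
    and strict: "\<And>A. \<lbrakk>A \<subseteq> V; 2 \<le> card A; A \<noteq> V\<rbrakk> \<Longrightarrow> feasible m m (leaving E t h p b A) (entering E t h p a A)"
    and balanced: "balanced m (leaving E t h p b {u}) (entering E t h p a {u})"
    and E: "e \<in> E" "e' \<in> E" and J: "joins t h e u y" "joins t h e' u w" and "y \<noteq> w"
  shows "admissible m V (E - {e'}) (t(e := y)) (h(e := w)) (p(u := p u - 1)) a b u"
proof -
  have ne: "e \<noteq> e'" using J assms(8) by (auto simp: joins_def)
  have V: "u \<in> V" "y \<in> V" "w \<in> V" "u \<noteq> y" "u \<noteq> w"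
    using joins_neq[OF I E(1) J(1)] joins_neq[OF I E(2) J(2)] by auto
  note fin = admissibleD(1,3)[OF I]
  note L = leaving_lift[OF fin(2) E ne J] entering_lift[OF fin(2) E ne J]
  show ?thesis
  proof (rule admissible_edit[OF I strict _ _ _ _ total_delete[OF fin E(2) V(1)]])
    fix v assume v: "v \<in> V" "V \<noteq> {v}"
    show "feasible m (m - 1) (leaving (E - {e'}) (t(e := y)) (h(e := w)) (p(u := p u - 1)) b {v})
           (entering (E - {e'}) (t(e := y)) (h(e := w)) (p(u := p u - 1)) a {v}) \<or>
          v = u \<and> balanced m (leaving (E - {e'}) (t(e := y)) (h(e := w)) (p(u := p u - 1)) b {v})
           (entering (E - {e'}) (t(e := y)) (h(e := w)) (p(u := p u - 1)) a {v})"
      using admissibleD(9)[OF I, of "{v}"] balanced_diff[OF balanced, of 1] v V assms(8) by (auto simp: L)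
  qed (use fin V admissibleD[OF I] assms(8) finite_subset[OF _ fin(1)] in
      \<open>auto simp: L split: if_splits\<close>)
qed

text \<open>The deleted edge is directed from \<open>x\<close> to \<open>y\<close>. Among single
  vertices this costs \<open>x\<close> one leaving arc and \<open>y\<close> one entering arc, and
  the last two assumptions say that both can spare it.\<close>

lemma admissible_delete:
  assumes I: "admissible m V E t h p a b u"
    and strict: "\<And>A. \<lbrakk>A \<subseteq> V; 2 \<le> card A; A \<noteq> V\<rbrakk> \<Longrightarrow> feasible m m (leaving E t h p b A) (entering E t h p a A)"
    and weak: "\<And>v. \<lbrakk>v \<in> V; V \<noteq> {v}\<rbrakk> \<Longrightarrow> feasible m (m - 1) (leaving E t h p b {v}) (entering E t h p a {v})"
    and E: "e \<in> E" and J: "joins t h e x y"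
    and x: "feasible m (m - 1) (leaving E t h p b {x} - 1) (entering E t h p a {x})"
    and y: "feasible m (m - 1) (leaving E t h p b {y}) (entering E t h p a {y} - 1)"
  shows "admissible m V (E - {e}) t h (p(x := p x - 1)) a b u"
proof -
  have V: "x \<in> V" "y \<in> V" "x \<noteq> y" using joins_neq[OF I E J] by auto
  note fin = admissibleD(1,3)[OF I]
  note L = leaving_delete[OF fin(2) E J] entering_delete[OF fin(2) E J]
  show ?thesis
    by (rule admissible_edit[OF I strict _ _ _ _ total_delete[OF fin E V(1)]])
      (use fin V admissibleD[OF I] x y weak finite_subset[OF _ fin(1)] in
        \<open>auto simp: L split: if_splits\<close>)
qed

text \<open>Splitting off at \<open>u\<close> with the root as one of the two neighbours: a root arc
  into \<open>u\<close> followed by the arc from \<open>u\<close> to \<open>y\<close> becomes a root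
  arc into \<open>y\<close>.\<close>

lemma admissible_shift_in:
  assumes I: "admissible m V E t h p a b u"
    and strict: "\<And>A. \<lbrakk>A \<subseteq> V; 2 \<le> card A; A \<noteq> V\<rbrakk> \<Longrightarrow> feasible m m (leaving E t h p b A) (entering E t h p a A)"
    and balanced: "balanced m (leaving E t h p b {u}) (entering E t h p a {u})"
    and E: "e \<in> E" and J: "joins t h e u y" and "0 < a u"
  shows "admissible m V (E - {e}) t h (p(u := p u - 1)) (a(u := a u - 1, y := a y + 1)) b u"
proof -
  have V: "u \<in> V" "y \<in> V" "u \<noteq> y" using joins_neq[OF I E J] by auto
  note fin = admissibleD(1,3)[OF I]
  \<comment> \<open>Two successive increments fit \<open>entering_upd\<close>; the forms agree
    because \<open>u\<close> and \<open>y\<close> differ.\<close>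
  have eq: "a(u := a u - 1, y := a y + 1) = (a(u := a u + (-1)))(y := (a(u := a u + (-1))) y + 1)"
    using V by auto
  have L: "finite A \<Longrightarrow> entering (E - {e}) t h (p(u := p u - 1)) (a(u := a u - 1, y := a y + 1)) A
      = entering E t h p a A - of_bool (u \<in> A \<and> y \<notin> A)" for A
    unfolding eq by (simp only: entering_upd entering_delete[OF fin(2) E J]) auto
  note L = leaving_delete[OF fin(2) E J] L
  show ?thesis
  proof (rule admissible_edit[OF I strict _ _ _ _ total_delete[OF fin E V(1)]])
    fix v assume v: "v \<in> V" "V \<noteq> {v}"
    show "feasible m (m - 1) (leaving (E - {e}) t h (p(u := p u - 1)) b {v})
           (entering (E - {e}) t h (p(u := p u - 1)) (a(u := a u - 1, y := a y + 1)) {v}) \<or>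
          v = u \<and> balanced m (leaving (E - {e}) t h (p(u := p u - 1)) b {v})
           (entering (E - {e}) t h (p(u := p u - 1)) (a(u := a u - 1, y := a y + 1)) {v})"
      using admissibleD(9)[OF I, of "{v}"] balanced_diff[OF balanced, of 1] v V by (auto simp: L)
  qed (use fin V admissibleD[OF I] assms(6) finite_subset[OF _ fin(1)] in
      \<open>auto simp: L split: if_splits\<close>)
qed

text \<open>The mirror case: the path from \<open>y\<close> over \<open>u\<close> to the root
  becomes one arc from \<open>y\<close> to the root.\<close>

lemma admissible_shift_out:
  assumes I: "admissible m V E t h p a b u"
    and strict: "\<And>A. \<lbrakk>A \<subseteq> V; 2 \<le> card A; A \<noteq> V\<rbrakk> \<Longrightarrow> feasible m m (leaving E t h p b A) (entering E t h p a A)"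
    and balanced: "balanced m (leaving E t h p b {u}) (entering E t h p a {u})"
    and E: "e \<in> E" and J: "joins t h e y u" and "0 < b u"
  shows "admissible m V (E - {e}) t h (p(y := p y - 1)) a (b(u := b u - 1, y := b y + 1)) u"
proof -
  have V: "u \<in> V" "y \<in> V" "u \<noteq> y" using joins_neq[OF I E J] by auto
  note fin = admissibleD(1,3)[OF I]
  have eq: "b(u := b u - 1, y := b y + 1) = (b(u := b u + (-1)))(y := (b(u := b u + (-1))) y + 1)"
    using V by auto
  have L: "finite A \<Longrightarrow> leaving (E - {e}) t h (p(y := p y - 1)) (b(u := b u - 1, y := b y + 1)) A
      = leaving E t h p b A - of_bool (u \<in> A \<and> y \<notin> A)" for A
    unfolding eq by (simp only: leaving_upd leaving_delete[OF fin(2) E J]) auto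
  note L = entering_delete[OF fin(2) E J] L
  show ?thesis
  proof (rule admissible_edit[OF I strict _ _ _ _ total_delete[OF fin E V(2)]])
    fix v assume v: "v \<in> V" "V \<noteq> {v}"
    show "feasible m (m - 1) (leaving (E - {e}) t h (p(y := p y - 1)) (b(u := b u - 1, y := b y + 1)) {v})
           (entering (E - {e}) t h (p(y := p y - 1)) a {v}) \<or>
          v = u \<and> balanced m (leaving (E - {e}) t h (p(y := p y - 1)) (b(u := b u - 1, y := b y + 1)) {v})
           (entering (E - {e}) t h (p(y := p y - 1)) a {v})"
      using admissibleD(9)[OF I, of "{v}"] balanced_diff[OF balanced, of 1] v V by (auto simp: L)
  qed (use fin V admissibleD[OF I] assms(6) finite_subset[OF _ fin(1)] in
      \<open>auto simp: L split: if_splits\<close>)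
qed

section \<open>Contraction of a vertex set\<close>

definition collapse :: "'v set \<Rightarrow> 'v \<Rightarrow> 'v \<Rightarrow> 'v" where
  "collapse A r x = (if x \<in> A then r else x)"

lemma sum_collapse:
  fixes f :: "'v \<Rightarrow> int"
  assumes "finite V" "A \<subseteq> V" "r \<in> A" "B \<subseteq> insert r (V - A)"
  shows "sum (f(r := c)) B = sum f {x \<in> V. collapse A r x \<in> B} + (c - sum f A) * of_bool (r \<in> B)"
proof (cases "r \<in> B")
  case True
  have "{x \<in> V. collapse A r x \<in> B} = (B - {r}) \<union> A"
    using assms(2-4) True by (auto simp: collapse_def)
  moreover have "finite B" "finite A" using assms finite_subset by (blast, blast)
  moreover have "(B - {r}) \<inter> A = {}" using assms(4) by auto
  ultimately have "sum f {x \<in> V. collapse A r x \<in> B} = sum f (B - {r}) + sum f A"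
    by (simp add: sum.union_disjoint)
  moreover have "sum (f(r := c)) B = c + sum f (B - {r})"
    using sum.remove[OF \<open>finite B\<close> True, of "f(r := c)"] by simp
  ultimately show ?thesis using True by simp
next
  case False
  then have "{x \<in> V. collapse A r x \<in> B} = B"
    using assms(2-4) by (auto simp: collapse_def)
  moreover have "sum (f(r := c)) B = sum f B"
    by (rule sum.cong) (use False in auto)
  ultimately show ?thesis using False by simp
qed

context
  fixes m :: int and V :: "'v set" and E :: "'e set" and t h :: "'e \<Rightarrow> 'v"
    and p a b :: "'v \<Rightarrow> int" and u r :: 'v and A :: "'v set"
  assumes I: "admissible m V E t h p a b u" and A: "A \<subseteq> V" and r: "r \<in> A"
begin

private definition "E2 = {e \<in> E. t e \<in> A \<and> h e \<in> A}"
text \<open>Edges inside \<open>A\<close> have their tail in \<open>A\<close> however they are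
  directed, so they use up \<open>card E2\<close> of \<open>sum p A\<close>; the rest is what the
  contracted vertex has to send out.\<close>

private definition "p1 = p(r := sum p A - int (card E2))"

lemma E2_sub: "E2 \<subseteq> E"
  by (auto simp: E2_def)

text \<open>Edges inside \<open>A\<close> are dropped instead of becoming loops at \<open>r\<close>.
  If \<open>B\<close> contains \<open>r\<close>, its preimage contains \<open>A\<close> and
  therefore all of these edges.\<close>

lemma inner_collapse:
  "inner (E - E2) (collapse A r \<circ> t) (collapse A r \<circ> h) B
    = inner E t h {x \<in> V. collapse A r x \<in> B} - int (card E2) * of_bool (r \<in> B)"
proof -
  let ?f = "\<lambda>e. of_bool (t e \<in> {x \<in> V. collapse A r x \<in> B} \<and> h e \<in> {x \<in> V. collapse A r x \<in> B}) :: int"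
  have "sum ?f E2 = (\<Sum>e\<in>E2. of_bool (r \<in> B))"
    by (rule sum.cong) (use A in \<open>auto simp: E2_def collapse_def\<close>)
  moreover have "inner (E - E2) (collapse A r \<circ> t) (collapse A r \<circ> h) B = sum ?f (E - E2)"
    unfolding inner_def by (rule sum.cong) (use admissibleD(4)[OF I] in auto)
  ultimately show ?thesis
    unfolding inner_def using sum.subset_diff[OF E2_sub admissibleD(3)[OF I], of ?f] by simp
qed

lemma touching_collapse:
  "touching (E - E2) (collapse A r \<circ> t) (collapse A r \<circ> h) B
    = touching E t h {x \<in> V. collapse A r x \<in> B} - int (card E2) * of_bool (r \<in> B)"
proof -
  let ?f = "\<lambda>e. of_bool (t e \<in> {x \<in> V. collapse A r x \<in> B} \<or> h e \<in> {x \<in> V. collapse A r x \<in> B}) :: int"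
  have "sum ?f E2 = (\<Sum>e\<in>E2. of_bool (r \<in> B))"
    by (rule sum.cong) (use A in \<open>auto simp: E2_def collapse_def\<close>)
  moreover have "touching (E - E2) (collapse A r \<circ> t) (collapse A r \<circ> h) B = sum ?f (E - E2)"
    unfolding touching_def by (rule sum.cong) (use admissibleD(4)[OF I] in auto)
  ultimately show ?thesis
    unfolding touching_def using sum.subset_diff[OF E2_sub admissibleD(3)[OF I], of ?f] by simp
qed

text \<open>The cuts of the contraction are the cuts of the graph that do not divide
  \<open>A\<close>. The corrections by \<open>card E2\<close> in \<open>p1\<close> and in the edge
  counts cancel, so \<open>leaving\<close> and \<open>entering\<close> keep their values.\<close>

lemma admissible_collapse:
  assumes "2 \<le> card A"
  shows "admissible m (insert r (V - A)) (E - E2) (collapse A r \<circ> t) (collapse A r \<circ> h) p1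
    (a(r := sum a A)) (b(r := sum b A)) u"
proof -
  note fin = admissibleD(1,3)[OF I]
  let ?V = "insert r (V - A)" let ?g = "collapse A r"
  let ?leaving = "\<lambda>B. leaving (E - E2) (?g \<circ> t) (?g \<circ> h) p1 (b(r := sum b A)) B"
  let ?entering = "\<lambda>B. entering (E - E2) (?g \<circ> t) (?g \<circ> h) p1 (a(r := sum a A)) B"
  have L: "?leaving B = leaving E t h p b {x \<in> V. ?g x \<in> B}" "?entering B = entering E t h p a {x \<in> V. ?g x \<in> B}"
    if "B \<subseteq> ?V" for B
    unfolding leaving_def entering_def p1_def inner_collapse touching_collapse sum_collapse[OF fin(1) A r that]
    by auto
  have top: "{x \<in> V. ?g x \<in> ?V} = V" by (auto simp: collapse_def)
  have "sum p1 ?V = sum p V - int (card E2)"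
    unfolding p1_def using sum_collapse[OF fin(1) A r subset_refl, of p] unfolding top by simp
  moreover have "int (card (E - E2)) = int (card E) - int (card E2)"
    using card_mono[OF fin(2) E2_sub] card_Diff_subset[OF finite_subset[OF E2_sub fin(2)] E2_sub]
    by (simp add: of_nat_diff)
  ultimately have tot: "[sum p1 ?V = int (card (E - E2))] (mod m)"
    using admissibleD(7)[OF I] by (simp add: cong_iff_dvd_diff)
  have cond: "feasible m (m - 1) (?leaving B) (?entering B) \<or> B = {u} \<and> balanced m (?leaving B) (?entering B)"
    if B: "B \<subseteq> ?V" "B \<noteq> {}" "B \<noteq> ?V" for B
  proof -
    let ?B = "{x \<in> V. ?g x \<in> B}"
    have "?B \<noteq> {}" using B A r by (auto simp: collapse_def)
    moreover have "?B \<noteq> V"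
    proof
      assume *: "?B = V"
      have "?g x = x" if "x \<in> ?V" for x using that r by (auto simp: collapse_def)
      moreover have "x \<in> V" if "x \<in> ?V" for x using that r A by auto
      ultimately have "?V \<subseteq> B" using * by force
      then show False using B by auto
    qed
    \<comment> \<open>The exception for \<open>u\<close> must carry over: a preimage with one
      element cannot contain all of \<open>A\<close>, so it equals \<open>B\<close>.\<close>
    moreover have "B = {u}" if "?B = {u}"
    proof -
      have "r \<notin> B"
      proof
        assume "r \<in> B"
        then have "A \<subseteq> ?B" using A by (auto simp: collapse_def)
        then have "card A \<le> 1" unfolding that by (metis card.empty card.insert card_mono empty_iff
              finite.intros is_singletonI is_singleton_altdef)
        then show False using assms by simp
      qed
      then have "?B = B" using B(1) by (auto simp: collapse_def)
      then show ?thesis using that by simp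
    qed
    ultimately show ?thesis
      using admissibleD(9)[OF I, of ?B] unfolding L[OF B(1)] by blast
  qed
  have nonneg: "0 \<le> (a(r := sum a A)) v \<and> 0 \<le> (b(r := sum b A)) v" if "v \<in> ?V" for v
    using that admissibleD(5,6)[OF I] A by (auto intro!: sum_nonneg)
  have edges: "(?g \<circ> t) e \<in> ?V \<and> (?g \<circ> h) e \<in> ?V \<and> (?g \<circ> t) e \<noteq> (?g \<circ> h) e" if "e \<in> E - E2" for e
    using that admissibleD(4)[OF I, of e] r by (auto simp: E2_def collapse_def)
  show ?thesis
    unfolding admissible_def
    using fin tot cond nonneg edges admissibleD(8)[OF I] L[OF subset_refl] unfolding top by simp
qed

text \<open>
  Once the contraction is oriented, the arcs between \<open>A\<close> and its complement become root arcs
  of the graph on \<open>A\<close>. This changes neither \<open>leaving\<close> nor \<open>entering\<close> on subsets of \<open>A\<close>, and the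
  failure of the strict condition for \<open>A\<close> is precisely the bound on the new root.
\<close>

lemma orientable_collapse:
  assumes strict: "\<not> feasible m m (leaving E t h p b A) (entering E t h p a A)"
    and one: "orientable m (insert r (V - A)) (E - E2) (collapse A r \<circ> t) (collapse A r \<circ> h) p1"
    and two: "\<And>p' a' b'. admissible m A E2 t h p' a' b' u \<Longrightarrow> orientable m A E2 t h p'"
  shows "orientable m V E t h p"
proof -
  note fin = admissibleD(1,3)[OF I]
  have finA: "finite A" using A fin finite_subset by blast
  let ?g = "collapse A r"
  obtain s where s: "\<And>v. v \<in> insert r (V - A) \<Longrightarrow>
      [outdeg s (E - E2) (?g \<circ> t) (?g \<circ> h) v = p1 v] (mod m)"
    using one unfolding orientable_def by blast
  have srcV: "src s t h e \<in> V" if "e \<in> E" for e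
    using admissibleD(4)[OF I that] by (auto simp: src_def)
  have g_src: "src s (?g \<circ> t) (?g \<circ> h) e = ?g (src s t h e)" for e
    by (simp add: src_def)
  define out where "out = outdeg s (E - E2) t h"
  \<comment> \<open>Negating \<open>s\<close> exchanges tails and heads, so \<open>inn\<close>
    counts entering arcs.\<close>
  define inn where "inn = outdeg (\<lambda>e. \<not> s e) (E - E2) t h"
  have sum_outdeg: "sum (outdeg s' F t h) B = (\<Sum>e\<in>F. of_bool (src s' t h e \<in> B))"
    if "finite B" "finite F" for s' F B
    unfolding outdeg_def using that by (subst sum.swap) (simp add: of_bool_def)
  \<comment> \<open>In the contraction \<open>r\<close> sends exactly the arcs that leave
    \<open>A\<close>, so their number has the residue prescribed by \<open>p1\<close>. This yields
    the total congruence for the graph on \<open>A\<close>.\<close>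
  have out_A: "[sum out A = sum p A - int (card E2)] (mod m)"
  proof -
    have "sum out A = outdeg s (E - E2) (?g \<circ> t) (?g \<circ> h) r"
      unfolding out_def sum_outdeg[OF finA finite_Diff[OF fin(2)]] unfolding outdeg_def g_src
      by (rule sum.cong) (use r in \<open>auto simp: collapse_def\<close>)
    then show ?thesis using s[of r] by (simp add: p1_def)
  qed
  let ?p = "\<lambda>v. p v - out v" let ?a = "\<lambda>v. a v + inn v" let ?b = "\<lambda>v. b v + out v"
  have L: "leaving E2 t h ?p ?b B = leaving E t h p b B" "entering E2 t h ?p ?a B = entering E t h p a B" if B: "B \<subseteq> A" for B
  proof -
    have finB: "finite B" using B finA finite_subset by blast
    have "inner E t h B = inner E2 t h B"
      unfolding inner_def
      by (rule sum.mono_neutral_right) (use fin(2) B in \<open>auto simp: E2_def\<close>)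
    then show "leaving E2 t h ?p ?b B = leaving E t h p b B"
      unfolding leaving_def by (simp add: sum.distrib sum_subtractf)
    have "touching E t h B = touching E2 t h B + touching (E - E2) t h B"
      unfolding touching_def using sum.subset_diff[OF E2_sub fin(2)] by (simp add: add.commute)
    also have "touching (E - E2) t h B = sum inn B + sum out B"
      unfolding touching_def inn_def out_def sum_outdeg[OF finB finite_Diff[OF fin(2)]]
        sum.distrib[symmetric]
      by (rule sum.cong) (use B in \<open>auto simp: E2_def src_def\<close>)
    finally show "entering E2 t h ?p ?a B = entering E t h p a B"
      unfolding entering_def by (simp add: sum.distrib sum_subtractf)
  qed
  have "admissible m A E2 t h ?p ?a ?b u"
    unfolding admissible_def
  proof (intro conjI allI impI ballI)
    show "finite A" "A \<noteq> {}" "finite E2" using finA r finite_subset[OF E2_sub fin(2)] by auto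
    show "t e \<in> A" "h e \<in> A" "t e \<noteq> h e" if "e \<in> E2" for e
      using that admissibleD(4)[OF I] by (auto simp: E2_def)
    show "0 \<le> ?a v" "0 \<le> ?b v" if "v \<in> A" for v
      using that A admissibleD(5,6)[OF I, of v] by (auto simp: inn_def out_def outdeg_def intro!: add_nonneg_nonneg sum_nonneg)
    show "[sum ?p A = int (card E2)] (mod m)"
      using out_A by (simp add: sum_subtractf cong_iff_dvd_diff dvd_diff_commute algebra_simps)
    show "\<not> feasible m m (leaving E2 t h ?p ?b A) (entering E2 t h ?p ?a A)"
      using strict L by simp
    fix B assume "B \<subseteq> A \<and> B \<noteq> {} \<and> B \<noteq> A"
    then show "feasible m (m - 1) (leaving E2 t h ?p ?b B) (entering E2 t h ?p ?a B) \<or>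
        B = {u} \<and> balanced m (leaving E2 t h ?p ?b B) (entering E2 t h ?p ?a B)"
      using L admissibleD(9)[OF I, of B] A by auto
  qed
  from two[OF this] obtain s2 where s2: "\<And>v. v \<in> A \<Longrightarrow> [outdeg s2 E2 t h v = ?p v] (mod m)"
    unfolding orientable_def by blast
  define s' where "s' = (\<lambda>e. if e \<in> E2 then s2 e else s e)"
  have split: "outdeg s' E t h v = outdeg s2 E2 t h v + out v" for v
  proof -
    have "outdeg s' E t h v = outdeg s' E2 t h v + outdeg s' (E - E2) t h v"
      unfolding outdeg_def using sum.subset_diff[OF E2_sub fin(2)] by (simp add: add.commute)
    moreover have "outdeg s' E2 t h v = outdeg s2 E2 t h v" "outdeg s' (E - E2) t h v = out v"
      unfolding out_def by (rule outdeg_cong; simp add: s'_def src_def)+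
    ultimately show ?thesis by simp
  qed
  have "[outdeg s' E t h v = p v] (mod m)" if v: "v \<in> V" for v
  proof (cases "v \<in> A")
    case True
    then show ?thesis using s2[OF True] split[of v] by (simp add: cong_iff_dvd_diff algebra_simps)
  next
    case False
    have "outdeg s2 E2 t h v = 0"
      unfolding outdeg_def by (rule sum.neutral) (use False in \<open>auto simp: E2_def src_def\<close>)
    moreover have "out v = outdeg s (E - E2) (?g \<circ> t) (?g \<circ> h) v"
      unfolding out_def outdeg_def g_src by (rule sum.cong) (use r False in \<open>auto simp: collapse_def\<close>)
    moreover have "v \<noteq> r" using False r by auto
    ultimately show ?thesis using s[of v] v False split[of v] by (simp add: p1_def)
  qed
  then show ?thesis unfolding orientable_def by blast
qed

text \<open>Both graphs have fewer vertices: the contraction because \<open>A\<close> has at least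
  two, the graph on \<open>A\<close> because \<open>A\<close> is a proper subset.\<close>

lemma orientable_contract:
  assumes "\<not> feasible m m (leaving E t h p b A) (entering E t h p a A)" "2 \<le> card A" "A \<noteq> V"
    and IH: "\<And>V' (E' :: 'e set) t' h' p' a' b'. admissible m V' E' t' h' p' a' b' u \<Longrightarrow> card V' < card V \<Longrightarrow> orientable m V' E' t' h' p'"
  shows "orientable m V E t h p"
proof (rule orientable_collapse[OF assms(1)])
  have fin: "finite V" "finite A" using admissibleD(1)[OF I] A finite_subset by auto
  have "card (V - A) = card V - card A" "card A \<le> card V"
    using fin A by (auto simp: card_Diff_subset card_mono)
  then have "card (insert r (V - A)) < card V"
    using assms(2) fin r by simp
  then show "orientable m (insert r (V - A)) (E - E2) (collapse A r \<circ> t) (collapse A r \<circ> h) p1"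
    using IH[OF admissible_collapse[OF assms(2)]] by simp
  have "card A < card V" using A assms(3) fin by (simp add: psubset_card_mono psubset_eq)
  then show "orientable m A E2 t h p'" if "admissible m A E2 t h p' a' b' u" for p' a' b'
    using IH[OF that] by simp
qed

end

section \<open>Balanced vertices\<close>

text \<open>All edges at \<open>u\<close> lead to \<open>y\<close>, and balance allows half of them
  to be directed each way. Then \<open>u\<close> can be removed: a cut of the smaller graph is an
  old cut with \<open>u\<close> on the side of \<open>y\<close>.\<close>

lemma orientable_remove_vertex:
  fixes E :: "'e set"
  assumes I: "admissible m V E t h p a b u" and balanced: "balanced m (leaving E t h p b {u}) (entering E t h p a {u})"
    and u: "u \<in> V" and y: "y \<in> V" "y \<noteq> u" and zero: "a u = 0" "b u = 0"
    and J: "\<And>e. e \<in> E \<Longrightarrow> t e = u \<or> h e = u \<Longrightarrow> joins t h e u y"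
    and IH: "\<And>(E' :: 'e set) p'. admissible m (V - {u}) E' t h p' a b u \<Longrightarrow> orientable m (V - {u}) E' t h p'"
  shows "orientable m V E t h p"
proof -
  note fin = admissibleD(1,3)[OF I]
  define F where "F = {e \<in> E. t e = u \<or> h e = u}"
  have F: "F \<subseteq> E" "finite F" using fin by (auto simp: F_def)
  have "inner E t h {u} = 0"
    unfolding inner_def by (rule sum.neutral) (use admissibleD(4)[OF I] in fastforce)
  moreover have "touching E t h {u} = (\<Sum>e\<in>F. 1)"
    unfolding touching_def F_def by (rule sum.mono_neutral_cong_right) (use fin in auto)
  ultimately obtain k where k: "p u + m * k = int (card F) - p u - m * k"
    using balanced zero unfolding balanced_def leaving_def entering_def by auto
  \<comment> \<open>The representative of \<open>p u\<close> modulo \<open>m\<close> that is half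
    the number of edges at \<open>u\<close>.\<close>
  define z where "z = p u + m * k"
  have z: "int (card F) = 2 * z" using k by (simp add: z_def algebra_simps)
  then have "nat z \<le> card F" "0 \<le> z" by linarith+
  then obtain G where G: "G \<subseteq> F" "int (card G) = z"
    using obtain_subset_with_card_n[of "nat z" F] by (metis int_nat_eq)
  \<comment> \<open>The edges of \<open>G\<close> will leave \<open>u\<close>; the other
    \<open>z\<close> edges of \<open>F\<close> will leave \<open>y\<close>.\<close>
  let ?p = "p(y := p y - z)"
  have L1: "leaving (E - F) t h ?p b B = leaving E t h p b B" "entering (E - F) t h ?p a B = entering E t h p a B"
    if B: "B \<subseteq> V - {u}" "y \<notin> B" for B
  proof -
    have "finite B" using B fin finite_subset by blast
    moreover have "inner (E - F) t h B = inner E t h B"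
      unfolding inner_def by (rule sum.mono_neutral_left) (use fin J B in \<open>auto simp: F_def joins_def\<close>)
    moreover have "touching (E - F) t h B = touching E t h B"
      unfolding touching_def by (rule sum.mono_neutral_left) (use fin J B in \<open>auto simp: F_def joins_def\<close>)
    ultimately show "leaving (E - F) t h ?p b B = leaving E t h p b B" "entering (E - F) t h ?p a B = entering E t h p a B"
      unfolding leaving_def entering_def by (simp_all only: sum_fun_upd_diff) (use B in auto)
  qed
  \<comment> \<open>Compared with \<open>insert u B\<close>, the value \<open>p u\<close> has been
    replaced by its representative \<open>z\<close>. This shifts the pair by \<open>m * k\<close>,
    so feasibility is unaffected.\<close>
  have L2: "leaving (E - F) t h ?p b B = leaving E t h p b (insert u B) + m * k"
      "entering (E - F) t h ?p a B = entering E t h p a (insert u B) - m * k"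
    if B: "B \<subseteq> V - {u}" "y \<in> B" for B
  proof -
    have finB: "finite B" "u \<notin> B" using B fin finite_subset by (blast, blast)
    have "inner E t h (insert u B) = inner (E - F) t h (insert u B) + inner F t h (insert u B)"
      unfolding inner_def using sum.subset_diff[OF F(1) fin(2)] by simp
    moreover have "inner (E - F) t h (insert u B) = inner (E - F) t h B"
      unfolding inner_def by (rule sum.cong) (auto simp: F_def)
    moreover have "inner F t h (insert u B) = (\<Sum>e\<in>F. 1)"
      unfolding inner_def by (rule sum.cong) (use J B in \<open>auto simp: F_def joins_def\<close>)
    ultimately have 1: "inner E t h (insert u B) = inner (E - F) t h B + int (card F)" by simp
    have "touching E t h (insert u B) = touching (E - F) t h (insert u B) + touching F t h (insert u B)"
      unfolding touching_def using sum.subset_diff[OF F(1) fin(2)] by simp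
    moreover have "touching (E - F) t h (insert u B) = touching (E - F) t h B"
      unfolding touching_def by (rule sum.cong) (auto simp: F_def)
    moreover have "touching F t h (insert u B) = (\<Sum>e\<in>F. 1)"
      unfolding touching_def by (rule sum.cong) (use J B in \<open>auto simp: F_def joins_def\<close>)
    ultimately have 2: "touching E t h (insert u B) = touching (E - F) t h B + int (card F)" by simp
    show "leaving (E - F) t h ?p b B = leaving E t h p b (insert u B) + m * k"
      "entering (E - F) t h ?p a B = entering E t h p a (insert u B) - m * k"
      unfolding leaving_def entering_def 1 2 sum_fun_upd_diff[OF finB(1)]
      using finB B z zero by (simp_all add: z_def)
  qed
  have "admissible m (V - {u}) (E - F) t h ?p a b u"
    unfolding admissible_def
  proof (intro conjI allI impI ballI)
    show "finite (V - {u})" "V - {u} \<noteq> {}" "finite (E - F)" using fin y by auto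
    show "t e \<in> V - {u}" "h e \<in> V - {u}" "t e \<noteq> h e" if "e \<in> E - F" for e
      using that admissibleD(4)[OF I, of e] by (auto simp: F_def)
    show "0 \<le> a v" "0 \<le> b v" if "v \<in> V - {u}" for v
      using that admissibleD(5,6)[OF I, of v] by auto
    have "sum ?p (V - {u}) = sum p V - p u - z"
      using fin u y by (simp only: sum_fun_upd_diff finite_Diff) (simp add: sum_diff1)
    moreover have "int (card (E - F)) = int (card E) - int (card F)"
      using F fin by (simp add: card_Diff_subset card_mono of_nat_diff)
    ultimately have "sum ?p (V - {u}) - int (card (E - F)) = (sum p V - int (card E)) + m * k"
      using z by (simp add: z_def)
    then show "[sum ?p (V - {u}) = int (card (E - F))] (mod m)"
      using admissibleD(7)[OF I] by (simp add: cong_iff_dvd_diff)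
    have "insert u (V - {u}) = V" using u by auto
    then show "\<not> feasible m m (leaving (E - F) t h ?p b (V - {u})) (entering (E - F) t h ?p a (V - {u}))"
      using L2[of "V - {u}"] y admissibleD(8)[OF I] by (simp add: feasible_shift)
    fix B assume B: "B \<subseteq> V - {u} \<and> B \<noteq> {} \<and> B \<noteq> V - {u}"
    have "feasible m (m - 1) (leaving (E - F) t h ?p b B) (entering (E - F) t h ?p a B)"
    proof (cases "y \<in> B")
      case True
      have "insert u B \<subseteq> V" "insert u B \<noteq> {u}" "insert u B \<noteq> V"
        using B u True y by auto
      then show ?thesis
        using L2[of B] True B admissibleD(9)[OF I, of "insert u B"] by (auto simp: feasible_shift)
    next
      case False
      have "B \<subseteq> V" "B \<noteq> {u}" "B \<noteq> V" using B u by auto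
      then show ?thesis
        using L1[of B] False B admissibleD(9)[OF I, of B] by auto
    qed
    then show "feasible m (m - 1) (leaving (E - F) t h ?p b B) (entering (E - F) t h ?p a B) \<or>
        B = {u} \<and> balanced m (leaving (E - F) t h ?p b B) (entering (E - F) t h ?p a B)" ..
  qed
  from IH[OF this] obtain s where
    s: "\<And>v. v \<in> V - {u} \<Longrightarrow> [outdeg s (E - F) t h v = ?p v] (mod m)"
    unfolding orientable_def by blast
  define s' where "s' = (\<lambda>e. if e \<in> G then t e = u else if e \<in> F then t e = y else s e)"
  have src: "src s' t h e = (if e \<in> G then u else y)" if "e \<in> F" for e
    using J[of e] that G(1) y by (auto simp: s'_def src_def F_def joins_def)
  have split: "outdeg s' E t h v = outdeg s (E - F) t h v + of_bool (v = u) * z + of_bool (v = y) * z" for v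
  proof -
    have "outdeg s' E t h v = outdeg s' (E - F) t h v + outdeg s' F t h v"
      unfolding outdeg_def using sum.subset_diff[OF F(1) fin(2)] by simp
    moreover have "outdeg s' (E - F) t h v = outdeg s (E - F) t h v"
      by (rule outdeg_cong) (use G(1) in \<open>auto simp: s'_def src_def\<close>)
    moreover have "outdeg s' F t h v = of_bool (v = u) * z + of_bool (v = y) * z"
    proof -
      have "outdeg s' F t h v = outdeg s' (F - G) t h v + outdeg s' G t h v"
        unfolding outdeg_def using sum.subset_diff[OF G(1) F(2)] by simp
      moreover have "outdeg s' (F - G) t h v = (\<Sum>e\<in>F - G. of_bool (y = v))"
        unfolding outdeg_def by (rule sum.cong) (auto simp: src)
      moreover have "outdeg s' G t h v = (\<Sum>e\<in>G. of_bool (u = v))"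
        unfolding outdeg_def by (rule sum.cong) (use G(1) in \<open>auto simp: src\<close>)
      moreover have "int (card (F - G)) = z"
        using G F z finite_subset[OF G(1)] card_mono[OF F(2) G(1)] by (simp add: card_Diff_subset of_nat_diff)
      ultimately show ?thesis using G(2) by auto
    qed
    ultimately show ?thesis by simp
  qed
  have "[outdeg s' E t h v = p v] (mod m)" if v: "v \<in> V" for v
  proof (cases "v = u")
    case True
    have "outdeg s (E - F) t h u = 0"
      unfolding outdeg_def by (rule sum.neutral) (auto simp: F_def src_def)
    then show ?thesis using True split[of u] y by (simp add: z_def cong_iff_dvd_diff)
  next
    case False
    then show ?thesis
      using s[of v] v split[of v] by (cases "v = y") (auto simp: cong_iff_dvd_diff algebra_simps)
  qed
  then show ?thesis unfolding orientable_def by blast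
qed

lemma leaving_entering_no_cross:
  assumes "finite V" "finite E" "S \<subseteq> V" and "\<And>e. e \<in> E \<Longrightarrow> t e \<in> V \<and> h e \<in> V \<and> (t e \<in> S \<longleftrightarrow> h e \<in> S)"
  shows "leaving E t h p b V = leaving E t h p b S + leaving E t h p b (V - S)"
    "entering E t h p a V = entering E t h p a S + entering E t h p a (V - S)"
proof -
  have "inner E t h V = inner E t h S + inner E t h (V - S)"
    unfolding inner_def sum.distrib[symmetric] by (rule sum.cong) (use assms in auto)
  moreover have "touching E t h V = touching E t h S + touching E t h (V - S)"
    unfolding touching_def sum.distrib[symmetric] by (rule sum.cong) (use assms in auto)
  moreover have "sum f V = sum f S + sum f (V - S)" for f :: "'a \<Rightarrow> int"
    using sum.subset_diff[OF assms(3,1)] by (simp add: add.commute)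
  note this[of p] this[of a] this[of b]
  ultimately show "leaving E t h p b V = leaving E t h p b S + leaving E t h p b (V - S)"
    "entering E t h p a V = entering E t h p a S + entering E t h p a (V - S)"
    unfolding leaving_def entering_def by simp_all
qed

lemma feasible_add:
  assumes "feasible m c x y" "feasible m c' x' y'"
  shows "feasible m (c + c') (x + x') (y + y')"
proof -
  obtain k k' where "c \<le> x + m * k" "c \<le> y - m * k" "c' \<le> x' + m * k'" "c' \<le> y' - m * k'"
    using assms unfolding feasible_def by blast
  then show ?thesis
    unfolding feasible_def by (intro exI[of _ "k + k'"]) (simp add: algebra_simps)
qed

text \<open>Otherwise the counts of \<open>S\<close> and \<open>V - S\<close> add up to those of
  \<open>V\<close>, which then reach \<open>2 * (m - 1)\<close> each way. This is at least
  \<open>m\<close> and contradicts the root bound.\<close>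

lemma exists_crossing_edge:
  assumes m: "2 \<le> m" and I: "admissible m V E t h p a b u"
    and weak: "\<And>A. \<lbrakk>A \<subseteq> V; A \<noteq> {}; A \<noteq> V\<rbrakk> \<Longrightarrow> feasible m (m - 1) (leaving E t h p b A) (entering E t h p a A)"
    and S: "S \<subseteq> V" "S \<noteq> {}" "S \<noteq> V"
  obtains e x y where "e \<in> E" "joins t h e x y" "x \<in> S" "y \<in> V - S"
proof -
  have "\<exists>e\<in>E. (t e \<in> S) \<noteq> (h e \<in> S)"
  proof (rule ccontr)
    assume "\<not> ?thesis"
    then have "leaving E t h p b V = leaving E t h p b S + leaving E t h p b (V - S)"
      "entering E t h p a V = entering E t h p a S + entering E t h p a (V - S)"
      using leaving_entering_no_cross[OF admissibleD(1,3)[OF I] S(1)] admissibleD(4)[OF I] by metis+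
    moreover have "feasible m (m - 1 + (m - 1)) (leaving E t h p b S + leaving E t h p b (V - S))
        (entering E t h p a S + entering E t h p a (V - S))"
      by (rule feasible_add) (use weak S in auto)
    ultimately have "feasible m m (leaving E t h p b V) (entering E t h p a V)"
      using m by (auto elim!: feasible_mono)
    then show False using admissibleD(8)[OF I] by simp
  qed
  then show ?thesis
    using that admissibleD(4)[OF I] unfolding joins_def by (metis Diff_iff)
qed

text \<open>Pairs at \<open>u\<close> with different other ends, the root included, are split off.
  If there are none, either all edges at \<open>u\<close> lead to one neighbour and \<open>u\<close>
  is removed, or \<open>u\<close> has root arcs only, which the root bound excludes.\<close>

lemma orientable_balanced:
  fixes E :: "'e set"
  assumes m: "2 \<le> m" and I: "admissible m V E t h p a b u" and u: "u \<in> V" "V \<noteq> {u}"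
    and balanced: "balanced m (leaving E t h p b {u}) (entering E t h p a {u})"
    and strict: "\<And>A. \<lbrakk>A \<subseteq> V; 2 \<le> card A; A \<noteq> V\<rbrakk> \<Longrightarrow> feasible m m (leaving E t h p b A) (entering E t h p a A)"
    and IH: "\<And>V' (E' :: 'e set) t' h' p' a' b'. admissible m V' E' t' h' p' a' b' u \<Longrightarrow>
      card V' < card V \<or> V' = V \<and> card E' < card E \<Longrightarrow> orientable m V' E' t' h' p'"
  shows "orientable m V E t h p"
proof -
  note fin = admissibleD(1,3)[OF I]
  have nonneg: "0 \<le> a u" "0 \<le> b u" using admissibleD(5,6)[OF I u(1)] .
  have ends: "\<exists>y. joins t h e u y" if "t e = u \<or> h e = u" for e
    using that by (auto simp: joins_def)
  consider (isolated) "a u + b u > 0" "\<And>e. e \<in> E \<Longrightarrow> t e \<noteq> u \<and> h e \<noteq> u"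
    | (incoming) e y where "a u > 0" "e \<in> E" "joins t h e u y"
    | (outgoing) e y where "b u > 0" "e \<in> E" "joins t h e u y"
    | (lift) e e' y w where "e \<in> E" "e' \<in> E" "joins t h e u y" "joins t h e' u w" "y \<noteq> w"
    | (single) "a u = 0" "b u = 0" "\<And>e e' y w. \<lbrakk>e \<in> E; e' \<in> E; joins t h e u y; joins t h e' u w\<rbrakk> \<Longrightarrow> y = w"
    using nonneg ends by (metis add_nonneg_eq_0_iff add_nonneg_pos add_pos_nonneg order_le_less)
  then show ?thesis
  proof cases
    case isolated
    have "leaving E t h p b V = leaving E t h p b {u} + leaving E t h p b (V - {u})"
      "entering E t h p a V = entering E t h p a {u} + entering E t h p a (V - {u})"
      using leaving_entering_no_cross[OF fin, of "{u}"] admissibleD(4)[OF I] u isolated(2) by auto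
    \<comment> \<open>The two equal counts at \<open>u\<close> have the positive sum
      \<open>a u + b u\<close>, so each is at least 1. Together with \<open>m - 1\<close> from the
      other vertices this violates the root bound.\<close>
    moreover have "feasible m 1 (leaving E t h p b {u}) (entering E t h p a {u})"
    proof -
      have "inner E t h {u} = 0" "touching E t h {u} = 0"
        unfolding inner_def touching_def by (rule sum.neutral; use isolated(2) in auto)+
      then have "leaving E t h p b {u} + entering E t h p a {u} = a u + b u"
        by (simp add: leaving_def entering_def)
      moreover obtain k where "leaving E t h p b {u} + m * k = entering E t h p a {u} - m * k"
        using balanced unfolding balanced_def by blast
      ultimately show ?thesis
        using isolated(1) unfolding feasible_def by (intro exI[of _ k]) linarith
    qed
    moreover have "feasible m (m - 1) (leaving E t h p b (V - {u})) (entering E t h p a (V - {u}))"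
    proof -
      have "V - {u} \<noteq> {}" "V - {u} \<noteq> V" "V - {u} \<noteq> {u}" using u by auto
      then show ?thesis using admissibleD(9)[OF I, of "V - {u}"] by blast
    qed
    ultimately have "feasible m m (leaving E t h p b V) (entering E t h p a V)"
      using feasible_add[of m 1 _ _ "m - 1"] by fastforce
    then show ?thesis using admissibleD(8)[OF I] by blast
  next
    case incoming
    have "admissible m V (E - {e}) t h (p(u := p u - 1)) (a(u := a u - 1, y := a y + 1)) b u"
      by (rule admissible_shift_in[OF I strict balanced incoming(2,3,1)])
    from IH[OF this] show ?thesis
      using orientable_delete[OF fin(2) incoming(2,3)] card_Diff1_less[OF fin(2) incoming(2)] by blast
  next
    case outgoing
    note J = joins_sym[OF outgoing(3)]
    have "admissible m V (E - {e}) t h (p(y := p y - 1)) a (b(u := b u - 1, y := b y + 1)) u"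
      by (rule admissible_shift_out[OF I strict balanced outgoing(2) J outgoing(1)])
    from IH[OF this] show ?thesis
      using orientable_delete[OF fin(2) outgoing(2) J] card_Diff1_less[OF fin(2) outgoing(2)] by blast
  next
    case lift
    have "e \<noteq> e'" "u \<noteq> y" "u \<noteq> w"
      using lift joins_neq[OF I lift(1,3)] joins_neq[OF I lift(2,4)] by (auto simp: joins_def)
    moreover have "admissible m V (E - {e'}) (t(e := y)) (h(e := w)) (p(u := p u - 1)) a b u"
      by (rule admissible_lift[OF I strict balanced lift])
    from IH[OF this] have "orientable m V (E - {e'}) (t(e := y)) (h(e := w)) (p(u := p u - 1))"
      using card_Diff1_less[OF fin(2) lift(2)] by blast
    ultimately show ?thesis
      using orientable_lift[OF fin(2) lift(1,2) _ lift(3-5)] by blast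
  next
    case single
    \<comment> \<open>If \<open>u\<close> has no edges, any other vertex serves as
      \<open>y\<close>.\<close>
    obtain y where y: "y \<in> V" "y \<noteq> u" "\<And>e. \<lbrakk>e \<in> E; t e = u \<or> h e = u\<rbrakk> \<Longrightarrow> joins t h e u y"
    proof (cases "\<exists>e\<in>E. t e = u \<or> h e = u")
      case True
      then obtain e y where e: "e \<in> E" "joins t h e u y" using ends by blast
      have "joins t h e' u y" if e': "e' \<in> E" "t e' = u \<or> h e' = u" for e'
      proof -
        obtain w where w: "joins t h e' u w" using ends e'(2) by blast
        then show ?thesis using single(3)[OF e(1) e'(1) e(2) w] by simp
      qed
      then show ?thesis using that joins_neq[OF I e] by metis
    next
      case False
      then show ?thesis using that u by blast
    qed
    show ?thesis
      by (rule orientable_remove_vertex[OF I balanced u(1) y(1,2) single(1,2) y(3)])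
        (use IH card_Diff1_less[OF fin(1) u(1)] in blast)+
  qed
qed

section \<open>Graphs without balanced vertices\<close>

text \<open>Two unequal counts are both at least \<open>m - 1\<close>, so the larger one has an arc
  to spare.\<close>

lemma feasible_unbalanced:
  assumes "feasible m (m - 1) x y" "\<not> balanced m x y"
  shows "feasible m (m - 1) (x - 1) y \<or> feasible m (m - 1) x (y - 1)"
proof -
  obtain k where k: "m - 1 \<le> x + m * k" "m - 1 \<le> y - m * k"
    using assms(1) unfolding feasible_def by blast
  have "x + m * k \<noteq> y - m * k" using assms(2) unfolding balanced_def by blast
  then consider "m - 1 \<le> x + m * k - 1" | "m - 1 \<le> y - m * k - 1" using k by linarith
  then show ?thesis
    by cases (use k in \<open>auto simp: feasible_def intro!: exI[of _ k]\<close>)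
qed

text \<open>A vertex with a spare leaving arc can drop an arc to the root; \<open>p\<close> stays,
  as it does not count root arcs.\<close>

lemma admissible_reduce_leaving:
  assumes I: "admissible m V E t h p a b u"
    and strict: "\<And>A. \<lbrakk>A \<subseteq> V; 2 \<le> card A; A \<noteq> V\<rbrakk> \<Longrightarrow> feasible m m (leaving E t h p b A) (entering E t h p a A)"
    and weak: "\<And>v. \<lbrakk>v \<in> V; V \<noteq> {v}\<rbrakk> \<Longrightarrow> feasible m (m - 1) (leaving E t h p b {v}) (entering E t h p a {v})"
    and v: "v \<in> V" "0 < b v" "feasible m (m - 1) (leaving E t h p b {v} - 1) (entering E t h p a {v})"
  shows "admissible m V E t h p a (b(v := b v - 1)) u"
proof -
  note L = leaving_upd[of _ E t h p b v "- 1", simplified]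
  show ?thesis
  proof (rule admissible_edit[OF I strict])
    show "\<not> feasible m m (leaving E t h p (b(v := b v - 1)) V) (entering E t h p a V)"
      using admissibleD(8)[OF I] v(1) feasible_mono[of m m "leaving E t h p b V - 1" "entering E t h p a V" m "leaving E t h p b V" "entering E t h p a V"]
      by (auto simp: L admissibleD(1)[OF I])
  qed (use weak v admissibleD[OF I] finite_subset[OF _ admissibleD(1)[OF I]] in \<open>auto simp: L\<close>)
qed

lemma admissible_reduce_entering:
  assumes I: "admissible m V E t h p a b u"
    and strict: "\<And>A. \<lbrakk>A \<subseteq> V; 2 \<le> card A; A \<noteq> V\<rbrakk> \<Longrightarrow> feasible m m (leaving E t h p b A) (entering E t h p a A)"
    and weak: "\<And>v. \<lbrakk>v \<in> V; V \<noteq> {v}\<rbrakk> \<Longrightarrow> feasible m (m - 1) (leaving E t h p b {v}) (entering E t h p a {v})"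
    and v: "v \<in> V" "0 < a v" "feasible m (m - 1) (leaving E t h p b {v}) (entering E t h p a {v} - 1)"
  shows "admissible m V E t h p (a(v := a v - 1)) b u"
proof -
  note L = entering_upd[of _ E t h p a v "- 1", simplified]
  show ?thesis
  proof (rule admissible_edit[OF I strict])
    show "\<not> feasible m m (leaving E t h p b V) (entering E t h p (a(v := a v - 1)) V)"
      using admissibleD(8)[OF I] v(1) feasible_mono[of m m "leaving E t h p b V" "entering E t h p a V - 1" m "leaving E t h p b V" "entering E t h p a V"]
      by (auto simp: L admissibleD(1)[OF I])
  qed (use weak v admissibleD[OF I] finite_subset[OF _ admissibleD(1)[OF I]] in \<open>auto simp: L\<close>)
qed

lemma inner_touching_all:
  assumes "admissible m V E t h p a b u"
  shows "inner E t h V = int (card E)" "touching E t h V = int (card E)"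
proof -
  have "inner E t h V = (\<Sum>e\<in>E. 1)" "touching E t h V = (\<Sum>e\<in>E. 1)"
    unfolding inner_def touching_def by (rule sum.cong; use admissibleD(4)[OF assms] in simp)+
  then show "inner E t h V = int (card E)" "touching E t h V = int (card E)" by simp_all
qed

text \<open>
  Without arcs into the root, \<open>m - 1\<close> of them can be added; they let \<open>x\<close> switch to the
  next representative of its residue and hence receive an arc from \<open>y\<close>.
\<close>

lemma feasible_boost:
  assumes "0 < m" "m dvd x" "\<not> feasible m m x y"
  shows "\<not> feasible m m (x + (m - 1)) y"
proof
  obtain j where j: "x = m * j" using assms(2) by auto
  assume "feasible m m (x + (m - 1)) y"
  then obtain k where k: "m \<le> x + (m - 1) + m * k" "m \<le> y - m * k" unfolding feasible_def by blast
  \<comment> \<open>Adding \<open>m - 1\<close> to the multiple \<open>x + m * k\<close> of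
    \<open>m\<close> reaches \<open>m\<close> only if this multiple is positive, and then it is at
    least \<open>m\<close> by itself.\<close>
  then have "0 < m * (j + k)" using j by (simp add: algebra_simps)
  then have "1 \<le> j + k" using assms(1) by (simp add: zero_less_mult_iff)
  then have "m * 1 \<le> m * (j + k)" using assms(1) by (intro mult_left_mono) auto
  then have "m \<le> x + m * k" using j by (simp add: algebra_simps)
  then show False using k(2) assms(3) unfolding feasible_def by blast
qed

lemma feasible_swap: "feasible m c x y \<Longrightarrow> feasible m c y x"
  unfolding feasible_def by (metis (no_types, lifting) add_uminus_conv_diff diff_minus_eq_add mult_minus_right)

lemma admissible_boost_leaving:
  assumes m: "2 \<le> m" and I: "admissible m V E t h p a b u"
    and strict: "\<And>A. \<lbrakk>A \<subseteq> V; 2 \<le> card A; A \<noteq> V\<rbrakk> \<Longrightarrow> feasible m m (leaving E t h p b A) (entering E t h p a A)"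
    and weak: "\<And>v. \<lbrakk>v \<in> V; V \<noteq> {v}\<rbrakk> \<Longrightarrow> feasible m (m - 1) (leaving E t h p b {v}) (entering E t h p a {v})"
    and zero: "\<And>v. v \<in> V \<Longrightarrow> b v = 0"
    and E: "e \<in> E" and J: "joins t h e y x"
    and y: "feasible m (m - 1) (leaving E t h p b {y} - 1) (entering E t h p a {y})"
    and x: "feasible m (m - 1) (leaving E t h p b {x} - 1) (entering E t h p a {x})"
  shows "admissible m V (E - {e}) t h (p(y := p y - 1)) a (b(x := b x + (m - 1))) u"
proof -
  have V: "x \<in> V" "y \<in> V" "x \<noteq> y" using joins_neq[OF I E J] by auto
  note fin = admissibleD(1,3)[OF I]
  let ?b = "b(x := b x + (m - 1))"
  have finA: "finite A" if "A \<subseteq> V" for A using that fin finite_subset by blast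
  note L = leaving_upd[of _ E t h p b x "m - 1"]
  \<comment> \<open>Without arcs into the root this is \<open>sum p V - card E\<close>, a multiple
    of \<open>m\<close> by the total congruence.\<close>
  have "m dvd leaving E t h p b V"
    using admissibleD(7)[OF I] zero inner_touching_all[OF I] by (simp add: leaving_def cong_iff_dvd_diff)
  then have top: "\<not> feasible m m (leaving E t h p ?b V) (entering E t h p a V)"
    using feasible_boost[of m "leaving E t h p b V"] admissibleD(8)[OF I] m V unfolding L[OF fin(1)] by simp
  have strict': "feasible m m (leaving E t h p ?b A) (entering E t h p a A)"
    if "A \<subseteq> V" "2 \<le> card A" "A \<noteq> V" for A
    by (rule feasible_mono[OF strict[OF that]]) (use m in \<open>auto simp: leaving_upd[OF finA[OF that(1)]]\<close>)
  have weak': "feasible m (m - 1) (leaving E t h p ?b {v}) (entering E t h p a {v})" if "v \<in> V" "V \<noteq> {v}" for v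
    by (rule feasible_mono[OF weak[OF that]]) (use m in \<open>auto simp: leaving_upd\<close>)
  have I': "admissible m V E t h p a ?b u"
    by (rule admissible_edit[OF I strict])
      (use fin V admissibleD[OF I] m weak' top in \<open>auto simp: leaving_upd finA\<close>)
  have x': "feasible m (m - 1) (leaving E t h p ?b {x}) (entering E t h p a {x} - 1)"
  proof -
    obtain k where "m - 1 \<le> leaving E t h p b {x} - 1 + m * k" "m - 1 \<le> entering E t h p a {x} - m * k"
      using x unfolding feasible_def by blast
    then show ?thesis
      unfolding feasible_def L[OF finite.insertI[OF finite.emptyI]]
      \<comment> \<open>Passing from \<open>k\<close> to \<open>k - 1\<close> costs \<open>m\<close>
        leaving arcs: \<open>m - 1\<close> are the new ones and the last is the spare arc of
        \<open>x\<close>. In exchange \<open>entering\<close> gains \<open>m\<close>, which pays for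
        the arc from \<open>y\<close>.\<close>
      using m by (intro exI[of _ "k - 1"]) (simp add: algebra_simps)
  qed
  show ?thesis
    by (rule admissible_delete[OF I' strict' weak' E J _ x']) (use y V in \<open>auto simp: leaving_upd\<close>)
qed

text \<open>The mirror case: \<open>m - 1\<close> new arcs come from the root, and \<open>x\<close>
  passes from \<open>k\<close> to \<open>k + 1\<close>, which lets it send an arc to
  \<open>y\<close>.\<close>

lemma admissible_boost_entering:
  assumes m: "2 \<le> m" and I: "admissible m V E t h p a b u"
    and strict: "\<And>A. \<lbrakk>A \<subseteq> V; 2 \<le> card A; A \<noteq> V\<rbrakk> \<Longrightarrow> feasible m m (leaving E t h p b A) (entering E t h p a A)"
    and weak: "\<And>v. \<lbrakk>v \<in> V; V \<noteq> {v}\<rbrakk> \<Longrightarrow> feasible m (m - 1) (leaving E t h p b {v}) (entering E t h p a {v})"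
    and zero: "\<And>v. v \<in> V \<Longrightarrow> a v = 0"
    and E: "e \<in> E" and J: "joins t h e x y"
    and y: "feasible m (m - 1) (leaving E t h p b {y}) (entering E t h p a {y} - 1)"
    and x: "feasible m (m - 1) (leaving E t h p b {x}) (entering E t h p a {x} - 1)"
  shows "admissible m V (E - {e}) t h (p(x := p x - 1)) (a(x := a x + (m - 1))) b u"
proof -
  have V: "x \<in> V" "y \<in> V" "x \<noteq> y" using joins_neq[OF I E J] by auto
  note fin = admissibleD(1,3)[OF I]
  let ?a = "a(x := a x + (m - 1))"
  have finA: "finite A" if "A \<subseteq> V" for A using that fin finite_subset by blast
  note L = entering_upd[of _ E t h p a x "m - 1"]
  have "m dvd entering E t h p a V"
    using admissibleD(7)[OF I] zero inner_touching_all[OF I]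
    by (simp add: entering_def cong_iff_dvd_diff dvd_diff_commute)
  then have top: "\<not> feasible m m (leaving E t h p b V) (entering E t h p ?a V)"
    using feasible_boost[of m "entering E t h p a V" "leaving E t h p b V"] feasible_swap admissibleD(8)[OF I] m V unfolding L[OF fin(1)] by auto
  have strict': "feasible m m (leaving E t h p b A) (entering E t h p ?a A)"
    if "A \<subseteq> V" "2 \<le> card A" "A \<noteq> V" for A
    by (rule feasible_mono[OF strict[OF that]]) (use m in \<open>auto simp: entering_upd[OF finA[OF that(1)]]\<close>)
  have weak': "feasible m (m - 1) (leaving E t h p b {v}) (entering E t h p ?a {v})" if "v \<in> V" "V \<noteq> {v}" for v
    by (rule feasible_mono[OF weak[OF that]]) (use m in \<open>auto simp: entering_upd\<close>)
  have I': "admissible m V E t h p ?a b u"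
    by (rule admissible_edit[OF I strict])
      (use fin V admissibleD[OF I] m weak' top in \<open>auto simp: entering_upd finA\<close>)
  have x': "feasible m (m - 1) (leaving E t h p b {x} - 1) (entering E t h p ?a {x})"
  proof -
    obtain k where "m - 1 \<le> leaving E t h p b {x} + m * k" "m - 1 \<le> entering E t h p a {x} - 1 - m * k"
      using x unfolding feasible_def by blast
    then show ?thesis
      unfolding feasible_def L[OF finite.insertI[OF finite.emptyI]]
      using m by (intro exI[of _ "k + 1"]) (simp add: algebra_simps)
  qed
  show ?thesis
    by (rule admissible_delete[OF I' strict' weak' E J x']) (use y V in \<open>auto simp: entering_upd\<close>)
qed

text \<open>Every vertex can spare a leaving arc (\<open>send\<close>) or an entering arc
  (\<open>receive\<close>). An edge from \<open>send\<close> to \<open>receive\<close> is deleted,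
  and a root arc in a spare direction is dropped. If neither is possible, all vertices lie in one of
  the two sets, and \<open>m - 1\<close> root arcs are added there.\<close>

lemma orientable_unbalanced:
  fixes E :: "'e set"
  assumes m: "2 \<le> m" and I: "admissible m V E t h p a b u" and V: "2 \<le> card V"
    and balanced: "\<And>v. v \<in> V \<Longrightarrow> \<not> balanced m (leaving E t h p b {v}) (entering E t h p a {v})"
    and weak: "\<And>A. \<lbrakk>A \<subseteq> V; A \<noteq> {}; A \<noteq> V\<rbrakk> \<Longrightarrow> feasible m (m - 1) (leaving E t h p b A) (entering E t h p a A)"
    and strict: "\<And>A. \<lbrakk>A \<subseteq> V; 2 \<le> card A; A \<noteq> V\<rbrakk> \<Longrightarrow> feasible m m (leaving E t h p b A) (entering E t h p a A)"
    and IH: "\<And>(E' :: 'e set) p' a' b'. admissible m V E' t h p' a' b' u \<Longrightarrow>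
      card E' < card E \<or> E' = E \<and> sum a' V + sum b' V < sum a V + sum b V \<Longrightarrow> orientable m V E' t h p'"
  shows "orientable m V E t h p"
proof -
  note fin = admissibleD(1,3)[OF I]
  define send where "send = {v \<in> V. feasible m (m - 1) (leaving E t h p b {v} - 1) (entering E t h p a {v})}"
  define receive where "receive = {v \<in> V. feasible m (m - 1) (leaving E t h p b {v}) (entering E t h p a {v} - 1)}"
  have weak1: "feasible m (m - 1) (leaving E t h p b {v}) (entering E t h p a {v})" if "v \<in> V" "V \<noteq> {v}" for v
    using weak[of "{v}"] that by auto
  have "V \<noteq> {v}" for v using V by auto
  then have cover: "v \<in> send \<or> v \<in> receive" if "v \<in> V" for v
    using feasible_unbalanced[OF weak1 balanced] that by (auto simp: send_def receive_def)
  have sub: "send \<subseteq> V" "receive \<subseteq> V" by (auto simp: send_def receive_def)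
  have delete: "orientable m V E t h p"
    if e: "e \<in> E" "joins t h e x y" and i: "admissible m V (E - {e}) t h (p(x := p x - 1)) a' b' u" for e x y a' b'
    using orientable_delete[OF fin(2) e] IH[OF i] card_Diff1_less[OF fin(2) e(1)] by blast
  consider (edge) e x y where "e \<in> E" "joins t h e x y" "x \<in> send" "y \<in> receive"
    | (leaving) v where "v \<in> send" "b v > 0" | (entering) v where "v \<in> receive" "a v > 0"
    | (rest) "\<And>e x y. \<lbrakk>e \<in> E; joins t h e x y; x \<in> send; y \<in> receive\<rbrakk> \<Longrightarrow> False"
        "\<And>v. v \<in> send \<Longrightarrow> b v = 0" "\<And>v. v \<in> receive \<Longrightarrow> a v = 0"
    using admissibleD(5,6)[OF I] sub by (metis order_le_less subsetD)
  then show ?thesis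
  proof cases
    case edge
    have "admissible m V (E - {e}) t h (p(x := p x - 1)) a b u"
      by (rule admissible_delete[OF I strict weak1 edge(1,2)]) (use edge(3,4) in \<open>auto simp: send_def receive_def\<close>)
    then show ?thesis using delete[OF edge(1,2)] by blast
  next
    case leaving
    have "v \<in> V" using leaving sub by auto
    have "admissible m V E t h p a (b(v := b v - 1)) u"
      by (rule admissible_reduce_leaving[OF I strict weak1]) (use leaving in \<open>auto simp: send_def\<close>)
    from IH[OF this] show ?thesis
      using \<open>v \<in> V\<close> sum_fun_upd_diff[OF fin(1), of b v 1] by simp
  next
    case entering
    have "v \<in> V" using entering sub by auto
    have "admissible m V E t h p (a(v := a v - 1)) b u"
      by (rule admissible_reduce_entering[OF I strict weak1]) (use entering in \<open>auto simp: receive_def\<close>)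
    from IH[OF this] show ?thesis
      using \<open>v \<in> V\<close> sum_fun_upd_diff[OF fin(1), of a v 1] by simp
  next
    case rest
    obtain r where r: "r \<in> V" "{r} \<noteq> V" using V admissibleD(2)[OF I] \<open>\<And>v. V \<noteq> {v}\<close> by blast
    then have "{r} \<subseteq> V" "{r} \<noteq> {}" by auto
    obtain e x y where e: "e \<in> E" "joins t h e x y" "x \<in> {r}" "y \<in> V - {r}"
      by (rule exists_crossing_edge[OF m I weak \<open>{r} \<subseteq> V\<close> \<open>{r} \<noteq> {}\<close> r(2)])
    \<comment> \<open>By \<open>cover\<close>, an edge leaving a proper nonempty set
      \<open>send\<close> would end in \<open>receive\<close>.\<close>
    have "send = {} \<or> send = V"
    proof (rule ccontr)
      assume "\<not> (send = {} \<or> send = V)"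
      then have ne: "send \<noteq> {}" "send \<noteq> V" by auto
      obtain e x y where "e \<in> E" "joins t h e x y" "x \<in> send" "y \<in> V - send"
        by (rule exists_crossing_edge[OF m I weak sub(1) ne])
      then show False using rest(1) cover by blast
    qed
    then show ?thesis
    proof
      assume *: "send = V"
      have zero: "\<And>v. v \<in> V \<Longrightarrow> b v = 0" using rest(2) * by simp
      have "admissible m V (E - {e}) t h (p(y := p y - 1)) a (b(x := b x + (m - 1))) u"
        by (rule admissible_boost_leaving[OF m I strict weak1 zero e(1) joins_sym[OF e(2)]])
          (use * e r in \<open>auto simp: send_def\<close>)
      then show ?thesis using delete[OF e(1) joins_sym[OF e(2)]] by blast
    next
      assume "send = {}"
      then have *: "receive = V" using cover sub by auto
      have zero: "\<And>v. v \<in> V \<Longrightarrow> a v = 0" using rest(3) * by simp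
      have "admissible m V (E - {e}) t h (p(x := p x - 1)) (a(x := a x + (m - 1))) b u"
        by (rule admissible_boost_entering[OF m I strict weak1 zero e(1,2)])
          (use * e r in \<open>auto simp: receive_def\<close>)
      then show ?thesis using delete[OF e(1,2)] by blast
    qed
  qed
qed

section \<open>The induction\<close>

lemma orientable_singleton:
  assumes I: "admissible m V E t h p a b u" and "card V < 2"
  shows "orientable m V E t h p"
proof -
  have "card V = 1"
    using assms(2) admissibleD(1,2)[OF I] by (simp add: less_2_cases_iff)
  then obtain v where v: "V = {v}" by (auto simp: card_1_singleton_iff)
  then have "E = {}" using admissibleD(4)[OF I] by fastforce
  then show ?thesis
    using admissibleD(7)[OF I] v by (simp add: orientable_def outdeg_def cong_sym_eq)
qed

text \<open>Contraction and removal of a vertex lower the number of vertices, splitting off and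
  deletion the number of edges. Edges precede root arcs in the order because a deletion may come
  with \<open>m - 1\<close> new root arcs.\<close>

lemma orientable_admissible:
  fixes E :: "'e set"
  assumes m: "2 \<le> m" and "admissible m V E t h p a b u"
  shows "orientable m V E t h p"
  using assms(2)
proof (induction "(card V, card E, nat (sum a V + sum b V))" arbitrary: V E t h p a b u
    rule: wf_induct_rule[OF wf_lex_prod[OF wf_less_than wf_lex_prod[OF wf_less_than wf_less_than]]])
  case 1
  note I = 1(2)
  have IH: "orientable m V' E' t' h' p'"
    if "admissible m V' E' t' h' p' a' b' u'" "card V' < card V \<or> V' = V \<and> card E' < card E \<or>
      V' = V \<and> E' = E \<and> sum a' V + sum b' V < sum a V + sum b V"
    for V' t' h' p' a' b' u' and E' :: "'e set"
  proof (rule 1(1)[OF _ that(1)])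
    \<comment> \<open>On nonnegative sums \<open>nat\<close> keeps the strict decrease.\<close>
    have nonneg: "0 \<le> sum a V + sum b V" "0 \<le> sum a' V' + sum b' V'"
      by (intro add_nonneg_nonneg sum_nonneg admissibleD(5,6)[OF I] admissibleD(5,6)[OF that(1)]; assumption)+
    from that(2) show "((card V', card E', nat (sum a' V' + sum b' V')), card V, card E, nat (sum a V + sum b V))
      \<in> less_than <*lex*> less_than <*lex*> less_than"
    proof (elim disjE conjE)
      assume eq: "V' = V" "E' = E" and less: "sum a' V + sum b' V < sum a V + sum b V"
      have "nat (sum a' V + sum b' V) < nat (sum a V + sum b V)"
        using less nonneg unfolding eq(1) by linarith
      then show ?thesis unfolding eq by simp
    qed simp_all
  qed
  show ?case
  proof (cases "card V < 2")
    case True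
    then show ?thesis by (rule orientable_singleton[OF I])
  next
    case False
    then have V: "2 \<le> card V" by simp
    have V': "V \<noteq> {v}" for v using V by auto
    show ?thesis
    proof (cases "\<exists>A. A \<subseteq> V \<and> 2 \<le> card A \<and> A \<noteq> V \<and> \<not> feasible m m (leaving E t h p b A) (entering E t h p a A)")
      case True
      then obtain A where A: "A \<subseteq> V" "2 \<le> card A" "A \<noteq> V"
        "\<not> feasible m m (leaving E t h p b A) (entering E t h p a A)"
        by blast
      have "A \<noteq> {}" using A(2) by auto
      then obtain r where r: "r \<in> A" by blast
      show ?thesis
      proof (rule orientable_contract[OF I A(1) r A(4,2,3)])
        show "orientable m V' E' t' h' p'" if "admissible m V' E' t' h' p' a' b' u" "card V' < card V"
          for V' t' h' p' a' b' and E' :: "'e set"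
          by (rule IH[OF that(1)]) (use that(2) in simp)
      qed
    next
      case False
      then have strict: "\<And>A. \<lbrakk>A \<subseteq> V; 2 \<le> card A; A \<noteq> V\<rbrakk> \<Longrightarrow> feasible m m (leaving E t h p b A) (entering E t h p a A)"
        by blast
      have solve: "orientable m V E t h p"
        if "admissible m V E t h p a b v" "v \<in> V" "balanced m (leaving E t h p b {v}) (entering E t h p a {v})" for v
      proof (rule orientable_balanced[OF m that(1,2) V' that(3) strict])
        show "orientable m V' E' t' h' p'"
          if "admissible m V' E' t' h' p' a' b' v" "card V' < card V \<or> V' = V \<and> card E' < card E"
          for V' t' h' p' a' b' and E' :: "'e set"
          by (rule IH[OF that(1)]) (use that(2) in argo)
      qed
      show ?thesis
      proof (cases "u \<in> V \<and> balanced m (leaving E t h p b {u}) (entering E t h p a {u})")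
        case True
        then show ?thesis by (elim conjE) (rule solve[OF I])
      next
        case False
        have weak: "feasible m (m - 1) (leaving E t h p b A) (entering E t h p a A)" if "A \<subseteq> V" "A \<noteq> {}" "A \<noteq> V" for A
          using admissibleD(9)[OF I that] False that(1) by (elim disjE conjE) simp_all
        show ?thesis
        proof (cases "\<exists>v\<in>V. balanced m (leaving E t h p b {v}) (entering E t h p a {v})")
          case True
          then obtain v where v: "v \<in> V" "balanced m (leaving E t h p b {v}) (entering E t h p a {v})" by blast
          \<comment> \<open>All cuts are feasible here, so the exception can move from
            \<open>u\<close> to \<open>v\<close>.\<close>
          have "admissible m V E t h p a b v"
            unfolding admissible_def using admissibleD[OF I] weak by simp
          then show ?thesis using v by (rule solve)
        next
          case False
          then have balanced: "\<not> balanced m (leaving E t h p b {v}) (entering E t h p a {v})" if "v \<in> V" for v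
            using that by blast
          show ?thesis
          proof (rule orientable_unbalanced[OF m I V balanced weak strict])
            show "orientable m V E' t h p'"
              if "admissible m V E' t h p' a' b' u" "card E' < card E \<or> E' = E \<and> sum a' V + sum b' V < sum a V + sum b V"
              for p' a' b' and E' :: "'e set"
              by (rule IH[OF that(1)]) (use that(2) in argo)
          qed
        qed
      qed
    qed
  qed
qed

section \<open>Highly edge-connected graphs and their flows\<close>

lemma orientable_edge_connected:
  assumes m: "2 \<le> m" and V: "finite V" and E: "finite E" "\<And>e. e \<in> E \<Longrightarrow> t e \<in> V \<and> h e \<in> V \<and> t e \<noteq> h e"
    and conn: "\<And>A. \<lbrakk>A \<subseteq> V; A \<noteq> {}; A \<noteq> V\<rbrakk> \<Longrightarrow> 3 * (m - 1) \<le> int (card {e \<in> E. (t e \<in> A) \<noteq> (h e \<in> A)})"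
    and total: "[sum p V = int (card E)] (mod m)"
  shows "orientable m V E t h p"
proof (cases "V = {}")
  case True
  then show ?thesis by (simp add: orientable_def)
next
  case False
  let ?z = "\<lambda>_. 0 :: int"
  have leaving_entering: "leaving E t h p ?z A + entering E t h p ?z A = int (card {e \<in> E. (t e \<in> A) \<noteq> (h e \<in> A)})" for A
  proof -
    have "leaving E t h p ?z A + entering E t h p ?z A = (\<Sum>e\<in>E. of_bool ((t e \<in> A) \<noteq> (h e \<in> A)))"
      unfolding leaving_def entering_def inner_def touching_def by (simp add: sum_subtractf[symmetric])
        (rule sum.cong, auto)
    also have "\<dots> = (\<Sum>e\<in>{e \<in> E. (t e \<in> A) \<noteq> (h e \<in> A)}. 1)"
      by (rule sum.mono_neutral_cong_right) (use E in auto)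
    finally show ?thesis by simp
  qed
  have "\<not> feasible m m (leaving E t h p ?z V) (entering E t h p ?z V)"
  proof
    have none: "{e \<in> E. (t e \<in> V) \<noteq> (h e \<in> V)} = {}" using E(2) by auto
    then have "leaving E t h p ?z V + entering E t h p ?z V = 0" unfolding leaving_entering none by simp
    moreover assume "feasible m m (leaving E t h p ?z V) (entering E t h p ?z V)"
    ultimately show False using m unfolding feasible_def by force
  qed
  moreover have "feasible m (m - 1) (leaving E t h p ?z A) (entering E t h p ?z A)"
    if "A \<subseteq> V" "A \<noteq> {}" "A \<noteq> V" for A
  proof -
    \<comment> \<open>The shift \<open>- d\<close> brings \<open>leaving\<close> into the range from
      \<open>m - 1\<close> to \<open>2 * m - 2\<close>; of at least \<open>3 * (m - 1)\<close> cut
      edges this leaves \<open>m - 1\<close> for \<open>entering\<close>.\<close>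
    define d where "d = (leaving E t h p ?z A - (m - 1)) div m"
    define c where "c = (leaving E t h p ?z A - (m - 1)) mod m"
    have "0 \<le> c" "c < m" using m by (auto simp: c_def)
    moreover have "leaving E t h p ?z A - (m - 1) = m * d + c" by (simp add: c_def d_def)
    ultimately show ?thesis
      using conn[OF that] leaving_entering[of A] m unfolding feasible_def
      by (intro exI[of _ "- d"]) auto
  qed
  \<comment> \<open>The induction starts without root arcs. Every cut is feasible, so an arbitrary
    value can stand for the exceptional vertex.\<close>
  ultimately have "admissible m V E t h p ?z ?z (SOME v. True)"
    unfolding admissible_def using V E total False by simp
  then show ?thesis by (rule orientable_admissible[OF m])
qed

theorem theorem12:
  fixes k :: nat and V :: "'v set" and E :: "'e set" and tail head :: "'e \<Rightarrow> 'v"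
  assumes "k \<ge> 2"
    and "digraph V E tail head"
    and "edge_connected (nat \<lceil>real (6 * k) / real (k - 1)\<rceil>) V E tail head"
  shows "\<exists>f. is_antisymmetric_Zmod_flow (int (2 * k + 1)) V E tail head f"
proof -
  let ?m = "int (2 * k + 1)"
  have fin: "finite V" "finite E" and E: "\<And>e. e \<in> E \<Longrightarrow> tail e \<in> V \<and> head e \<in> V \<and> tail e \<noteq> head e"
    using assms(2) by (auto simp: digraph_def)
  let ?E = "E \<times> {..<k - 1}" let ?t = "\<lambda>x. tail (fst x)" let ?h = "\<lambda>x. head (fst x)"
  define dout where "dout v = int (card {e \<in> E. tail e = v})" for v
  define din where "din v = int (card {e \<in> E. head e = v})" for v
  \<comment> \<open>Chosen so that the net flow out of \<open>v\<close> under the values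
    \<open>2 * j e + 2\<close> equals twice the difference of the actual out-degree and
    \<open>p v\<close>.\<close>
  define p where "p v = int k * din v - dout v" for v
  \<comment> \<open>Each cut edge counts \<open>k - 1\<close> times, so a cut has at least
    \<open>6 * k = 3 * (?m - 1)\<close> edges.\<close>
  have conn: "3 * (?m - 1) \<le> int (card {x \<in> ?E. (?t x \<in> A) \<noteq> (?h x \<in> A)})"
    if "A \<subseteq> V" "A \<noteq> {}" "A \<noteq> V" for A
  proof -
    let ?C = "cut_edges E tail head A"
    have "{x \<in> ?E. (?t x \<in> A) \<noteq> (?h x \<in> A)} = ?C \<times> {..<k - 1}"
      by (auto simp: cut_edges_def)
    then have "card {x \<in> ?E. (?t x \<in> A) \<noteq> (?h x \<in> A)} = card ?C * (k - 1)"
      by (simp add: card_cartesian_product)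
    moreover have "nat \<lceil>real (6 * k) / real (k - 1)\<rceil> \<le> card ?C"
      using assms(3) that unfolding edge_connected_def by blast
    then have "real (6 * k) / real (k - 1) \<le> real (card ?C)"
      by (simp only: nat_le_iff ceiling_le_iff of_int_of_nat_eq)
    then have "real (6 * k) \<le> real (card ?C) * real (k - 1)"
      using assms(1) by (simp add: divide_le_eq)
    then have "6 * k \<le> card ?C * (k - 1)"
      by (simp only: of_nat_mult[symmetric] of_nat_le_iff)
    ultimately have "int (6 * k) \<le> int (card {x \<in> ?E. (?t x \<in> A) \<noteq> (?h x \<in> A)})"
      by (simp only: of_nat_le_iff)
    then show ?thesis by simp
  qed
  have deg: "(\<Sum>v\<in>V. int (card {e \<in> E. g e = v})) = int (card E)" if "\<And>e. e \<in> E \<Longrightarrow> g e \<in> V" for g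
    using sum.group[OF fin(2,1), of g "\<lambda>_. 1 :: int"] that by (simp add: image_subset_iff)
  have "sum p V = int k * int (card E) - int (card E)"
    unfolding p_def dout_def din_def sum_subtractf sum_distrib_left[symmetric]
    using deg[of head] deg[of tail] E by simp
  also have "\<dots> = int (card ?E)"
    using assms(1) by (simp add: card_cartesian_product algebra_simps of_nat_diff)
  finally have "orientable ?m V ?E ?t ?h p"
    by (intro orientable_edge_connected) (use assms(1) fin E conn in auto)
  then obtain s where s: "\<And>v. v \<in> V \<Longrightarrow> [outdeg s ?E ?t ?h v = p v] (mod ?m)"
    unfolding orientable_def by blast
  define j where "j e = (\<Sum>i<k - 1. of_bool (s (e, i)) :: int)" for e
  have j: "0 \<le> j e" "j e \<le> int k - 1" for e
  proof -
    show "0 \<le> j e" unfolding j_def by (rule sum_nonneg) simp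
    have "j e \<le> (\<Sum>i<k - 1. 1)" unfolding j_def by (rule sum_mono) simp
    then show "j e \<le> int k - 1" using assms(1) by (simp add: of_nat_diff)
  qed
  have filter: "sum g {e \<in> E. q e = v} = (\<Sum>e\<in>E. of_bool (q e = v) * g e)" for g :: "'e \<Rightarrow> int" and q :: "'e \<Rightarrow> 'v" and v
    by (rule sum.mono_neutral_cong_left) (use fin in auto)
  \<comment> \<open>A kept copy leaves the tail of its arc and a reversed one the head, so an arc
    \<open>e\<close> entering \<open>v\<close> contributes \<open>k - 1 - j e\<close>.\<close>
  have out: "outdeg s ?E ?t ?h v = sum j {e \<in> E. tail e = v} - sum j {e \<in> E. head e = v} + (int k - 1) * din v" for v
  proof -
    have "(\<Sum>i<k - 1. of_bool (src s ?t ?h (e, i) = v))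
        = of_bool (tail e = v) * j e - of_bool (head e = v) * j e + of_bool (head e = v) * (int k - 1)"
      if "e \<in> E" for e
    proof -
      have "(\<Sum>i<k - 1. of_bool (src s ?t ?h (e, i) = v))
        = (\<Sum>i<k - 1. of_bool (tail e = v) * of_bool (s (e, i)) - of_bool (head e = v) * of_bool (s (e, i))
            + of_bool (head e = v) :: int)"
        by (rule sum.cong) (use E[OF that] in \<open>auto simp: src_def\<close>)
      also have "\<dots> = of_bool (tail e = v) * j e - of_bool (head e = v) * j e + of_bool (head e = v) * (int k - 1)"
        using assms(1) by (simp only: sum.distrib sum_subtractf sum_distrib_left[symmetric] j_def)
          (simp add: of_nat_diff)
      finally show ?thesis .
    qed
    then have "outdeg s ?E ?t ?h v = (\<Sum>e\<in>E. of_bool (tail e = v) * j e - of_bool (head e = v) * j e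
        + of_bool (head e = v) * (int k - 1))"
      unfolding outdeg_def sum.cartesian_product' by (rule sum.cong[OF refl])
    also have "\<dots> = sum j {e \<in> E. tail e = v} - sum j {e \<in> E. head e = v} + sum (\<lambda>_. int k - 1) {e \<in> E. head e = v}"
      unfolding filter by (simp only: sum.distrib sum_subtractf)
    finally show ?thesis by (simp add: din_def mult.commute)
  qed
  let ?f = "\<lambda>e. 2 * j e + 2"
  have f_sum: "sum ?f X = 2 * sum j X + 2 * int (card X)" for X
    by (simp add: sum.distrib sum_distrib_left)
  have "[sum ?f {e \<in> E. tail e = v} - sum ?f {e \<in> E. head e = v} = 0] (mod ?m)" if "v \<in> V" for v
  proof -
    have eq: "sum ?f {e \<in> E. tail e = v} - sum ?f {e \<in> E. head e = v} = 2 * (outdeg s ?E ?t ?h v - p v)"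
      unfolding out p_def f_sum by (simp add: dout_def din_def algebra_simps)
    have "?m dvd outdeg s ?E ?t ?h v - p v"
      using s[OF that] by (simp only: cong_iff_dvd_diff)
    then show ?thesis unfolding eq cong_0_iff by (rule dvd_mult)
  qed
  moreover have "\<not> [?f e = - ?f e'] (mod ?m)" for e e'
  proof
    assume "[?f e = - ?f e'] (mod ?m)"
    then have "?m dvd 2 * (j e + j e' + 2)" by (simp add: cong_iff_dvd_diff algebra_simps)
    \<comment> \<open>The modulus is odd, so the factor 2 cancels; what remains lies between 2 and
      \<open>2 * k\<close> and is no multiple of \<open>?m\<close>.\<close>
    moreover have "coprime ?m 2" by simp
    ultimately have "?m dvd j e + j e' + 2" using coprime_dvd_mult_right_iff by blast
    moreover have "0 < j e + j e' + 2" using j(1)[of e] j(1)[of e'] by simp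
    ultimately have "?m \<le> j e + j e' + 2" by (rule zdvd_imp_le)
    then show False using j(2)[of e] j(2)[of e'] by simp
  qed
  ultimately show ?thesis
    unfolding is_antisymmetric_Zmod_flow_def is_Zmod_flow_def by blast
qed

end
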